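(* Assume that $f$ and $h$ are three times continuously differentiable and that the set $U$ of feasible inputs is compact. Let $x_0\in\mathbb{R}^{n_x}$ be an initial condition and $u$ an input trajectory. (1) If there exist $T>0$ and $\mu>0$ such that the system is regularly bounded at $x_0$ with horizon $T$ (for the input $u$) and such that for any $t\ge T$ $$\mathcal{C}(t,T,x(t-T),u)\succeq\mu I_{n_x},\qquad ( * )$$ then $u$ is a weakly regularly persistent input trajectory at $x_0$. (2) Conversely, suppose that $u$ is a weakly regularly persistent input trajectory at $x_0$ with an associated $\mathcal{K}$-function $\kappa$ that has finite sensitivity and an associated time horizon $T$ such that the system is regularly bounded at $x_0$ with horizon $T$ (for the input $u$). Then there exist $T>0$ and $\mu>0$ such that for any $t\ge T$, $( * )$ holds.
   Context: Let $n_x,n_u,n_y$ be positive integers, $\mathbb{R}^+=[0,\infty)$, $U\subset\mathbb{R}^{n_u}$, $f:\mathbb{R}^{n_x}\times\mathbb{R}^{n_u}\to\mathbb{R}^{n_x}$ and $h:\mathbb{R}^{n_x}\times\mathbb{R}^{n_u}\to\mathbb{R}^{n_y}$. The system is $\dot{x}=f(x,u)$, $y=h(x,u)$. An input trajectory is a piecewise continuous map $u:\mathbb{R}^+\to U$. Solutions are assumed to be uniquely defined at all times; $\phi_f(s_2;s_1,\xi,u)$ is the solution at time $s_2\ge s_1\ge 0$ starting from $\xi$ at time $s_1$ with input $u$. The reference trajectory is $x(t)=\phi_f(t;0,x_0,u)$. $\|\cdot\|$ is the Euclidean norm; $\overline{B}(a,R)$ is the closed Euclidean ball; $\succeq$ is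 the Loewner order; $I_{n_x}$ is the identity matrix. Cumulative output error: $l(t_1,t_2,\xi_1,\xi_2,u)=\int_{t_1}^{t_2}\|h(\phi_f(s;t_1,\xi_1,u),u(s))-h(\phi_f(s;t_1,\xi_2,u),u(s))\|^2\,\mathrm{d}s$ for $0\le t_1\le t_2$. A $\mathcal{K}$-function is a continuous strictly increasing $\kappa:\mathbb{R}^+\to\mathbb{R}$ with $\kappa(0)=0$. It has finite sensitivity if there is $r>0$ with $\inf_{0<\|\xi\|\le r}\kappa(\|\xi\|)/\|\xi\|^2>0$. $u$ is weakly regularly persistent at $x_0$ if there exist $T>0$ (associated time horizon), $R>0$ and a $\mathcal{K}$-function $\kappa$ (associated $\mathcal{K}$-function) such that for any $t\ge T$ and any $\xi_1,\xi_2\in\overline{B}(x(t-T),R)$: $l(t-T,t,\xi_1,\xi_2,u)\ge\kappa(\|\xi_1-\xi_2\|)$. The system is regularly bounded at $x_0$ with horizon $T$ (for the input $u$) if there exist $R>0$, $L>0$ such that for any $t\ge T$, $s\in[t-T,t]$, $\xi\in\overline{B}(x(t-T),R)$: $\|\phi_f(s;t-T,\xi,u)\|\le L$. Observability Grammian on $[t-T,t]$, $t\ge T$: half the Hessian of $l(t-T,t,x(t-T),\cdot,u)$ at $x(t-T)$, i.e. $$\mathcal{C}(t,T,x(t-T),u)=\int_{t-T}^{t}\Phi_f^{\top}H(x(s),u(s))^{\top}H(x(s),u(s))\Phi_f\,\mathrm{d}s,$$ where $H(x,u)=\mathrm{d}_xh(x,u)$ and $\Phi_f=\Phi_f(s;t-T,x(t-T),u)$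 is the differential of $\xi\mapsto\phi_f(s;t-T,\xi,u)$ at $\xi=x(t-T)$. *)

theory Defs
  imports "HOL-Analysis.Analysis"
begin

definition three_times_continuously_differentiable ::
    "('a::real_normed_vector \<Rightarrow> 'b::real_normed_vector) \<Rightarrow> bool" where
  "three_times_continuously_differentiable g \<longleftrightarrow>
     (\<exists>(D1 :: 'a \<Rightarrow> 'a \<Rightarrow>\<^sub>L 'b)
       (D2 :: 'a \<Rightarrow> 'a \<Rightarrow>\<^sub>L 'a \<Rightarrow>\<^sub>L 'b)
       (D3 :: 'a \<Rightarrow> 'a \<Rightarrow>\<^sub>L 'a \<Rightarrow>\<^sub>L 'a \<Rightarrow>\<^sub>L 'b).
        (\<forall>z. (g has_derivative blinfun_apply (D1 z)) (at z)) \<and>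
        (\<forall>z. (D1 has_derivative blinfun_apply (D2 z)) (at z)) \<and>
        (\<forall>z. (D2 has_derivative blinfun_apply (D3 z)) (at z)) \<and>
        continuous_on UNIV D3)"

(* The time domain is [0,\<infinity>): trajectories are functions on the reals whose values at
   negative times are irrelevant. *)
definition piecewise_continuous :: "(real \<Rightarrow> 'a::real_normed_vector) \<Rightarrow> bool" where
  "piecewise_continuous u \<longleftrightarrow>
     (\<forall>b. finite {t \<in> {0..b}. \<not> continuous (at t within {0..}) u}) \<and>
     (\<forall>t>0. \<exists>l. (u \<longlongrightarrow> l) (at_left t)) \<and>
     (\<forall>t\<ge>0. \<exists>l. (u \<longlongrightarrow> l) (at_right t))"

definition input_trajectory :: "'a::real_normed_vector set \<Rightarrow> (real \<Rightarrow> 'a) \<Rightarrow> bool" where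
  "input_trajectory U u \<longleftrightarrow> piecewise_continuous u \<and> (\<forall>t\<ge>0. u t \<in> U)"

(* As u may jump, the differential equation is only required at the continuity points of u;
   x itself has to be continuous throughout. *)
definition is_solution ::
    "(real ^ 'nx \<Rightarrow> real ^ 'nu \<Rightarrow> real ^ 'nx) \<Rightarrow> (real \<Rightarrow> real ^ 'nu) \<Rightarrow>
     real \<Rightarrow> real ^ 'nx \<Rightarrow> (real \<Rightarrow> real ^ 'nx) \<Rightarrow> bool" where
  "is_solution f u s1 \<xi> x \<longleftrightarrow>
     x s1 = \<xi> \<and> continuous_on {s1..} x \<and>
     (\<forall>t\<ge>s1. continuous (at t within {0..}) u \<longrightarrow>
        (x has_vector_derivative f (x t) (u t)) (at t within {s1..}))"

definition solutions_uniquely_defined ::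
    "(real ^ 'nx \<Rightarrow> real ^ 'nu \<Rightarrow> real ^ 'nx) \<Rightarrow> (real ^ 'nu) set \<Rightarrow> bool" where
  "solutions_uniquely_defined f U \<longleftrightarrow>
     (\<forall>u s1 \<xi>. input_trajectory U u \<longrightarrow> s1 \<ge> 0 \<longrightarrow>
        (\<exists>x. is_solution f u s1 \<xi> x) \<and>
        (\<forall>x y. is_solution f u s1 \<xi> x \<longrightarrow> is_solution f u s1 \<xi> y \<longrightarrow> (\<forall>t\<ge>s1. x t = y t)))"

(* flow f u s2 s1 \<xi> is the value at time s2 of the solution that starts from \<xi> at time s1. *)
definition flow ::
    "(real ^ 'nx \<Rightarrow> real ^ 'nu \<Rightarrow> real ^ 'nx) \<Rightarrow> (real \<Rightarrow> real ^ 'nu) \<Rightarrow>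
     real \<Rightarrow> real \<Rightarrow> real ^ 'nx \<Rightarrow> real ^ 'nx" where
  "flow f u s2 s1 \<xi> = (THE y. \<exists>x. is_solution f u s1 \<xi> x \<and> x s2 = y)"

definition reference_trajectory ::
    "(real ^ 'nx \<Rightarrow> real ^ 'nu \<Rightarrow> real ^ 'nx) \<Rightarrow> (real \<Rightarrow> real ^ 'nu) \<Rightarrow>
     real ^ 'nx \<Rightarrow> real \<Rightarrow> real ^ 'nx" where
  "reference_trajectory f u x0 t = flow f u t 0 x0"

definition cumulative_output_error ::
    "(real ^ 'nx \<Rightarrow> real ^ 'nu \<Rightarrow> real ^ 'nx) \<Rightarrow> (real ^ 'nx \<Rightarrow> real ^ 'nu \<Rightarrow> real ^ 'ny) \<Rightarrow>
     real \<Rightarrow> real \<Rightarrow> real ^ 'nx \<Rightarrow> real ^ 'nx \<Rightarrow> (real \<Rightarrow> real ^ 'nu) \<Rightarrow> real" where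
  "cumulative_output_error f h t1 t2 \<xi>1 \<xi>2 u =
     integral {t1..t2}
       (\<lambda>s. (norm (h (flow f u s t1 \<xi>1) (u s) - h (flow f u s t1 \<xi>2) (u s)))\<^sup>2)"

definition K_function :: "(real \<Rightarrow> real) \<Rightarrow> bool" where
  "K_function \<kappa> \<longleftrightarrow> continuous_on {0..} \<kappa> \<and> strict_mono_on {0..} \<kappa> \<and> \<kappa> 0 = 0"

(* The type argument is the space over which \<xi> ranges. *)
definition finite_sensitivity :: "'a::real_normed_vector itself \<Rightarrow> (real \<Rightarrow> real) \<Rightarrow> bool" where
  "finite_sensitivity _ \<kappa> \<longleftrightarrow>
     (\<exists>r>0. (INF \<xi>\<in>{\<xi>::'a. 0 < norm \<xi> \<and> norm \<xi> \<le> r}. \<kappa> (norm \<xi>) / (norm \<xi>)\<^sup>2) > 0)"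

(* T is an associated time horizon and \<kappa> an associated K-function, for a common radius R. *)
definition weakly_regularly_persistent_with ::
    "(real ^ 'nx \<Rightarrow> real ^ 'nu \<Rightarrow> real ^ 'nx) \<Rightarrow> (real ^ 'nx \<Rightarrow> real ^ 'nu \<Rightarrow> real ^ 'ny) \<Rightarrow>
     (real \<Rightarrow> real ^ 'nu) \<Rightarrow> real ^ 'nx \<Rightarrow> real \<Rightarrow> (real \<Rightarrow> real) \<Rightarrow> bool" where
  "weakly_regularly_persistent_with f h u x0 T \<kappa> \<longleftrightarrow>
     T > 0 \<and> K_function \<kappa> \<and>
     (\<exists>R>0. \<forall>t\<ge>T. \<forall>\<xi>1 \<in> cball (reference_trajectory f u x0 (t - T)) R.
        \<forall>\<xi>2 \<in> cball (reference_trajectory f u x0 (t - T)) R.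
          cumulative_output_error f h (t - T) t \<xi>1 \<xi>2 u \<ge> \<kappa> (norm (\<xi>1 - \<xi>2)))"

definition weakly_regularly_persistent ::
    "(real ^ 'nx \<Rightarrow> real ^ 'nu \<Rightarrow> real ^ 'nx) \<Rightarrow> (real ^ 'nx \<Rightarrow> real ^ 'nu \<Rightarrow> real ^ 'ny) \<Rightarrow>
     (real \<Rightarrow> real ^ 'nu) \<Rightarrow> real ^ 'nx \<Rightarrow> bool" where
  "weakly_regularly_persistent f h u x0 \<longleftrightarrow>
     (\<exists>T \<kappa>. weakly_regularly_persistent_with f h u x0 T \<kappa>)"

definition regularly_bounded ::
    "(real ^ 'nx \<Rightarrow> real ^ 'nu \<Rightarrow> real ^ 'nx) \<Rightarrow> (real \<Rightarrow> real ^ 'nu) \<Rightarrow>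
     real ^ 'nx \<Rightarrow> real \<Rightarrow> bool" where
  "regularly_bounded f u x0 T \<longleftrightarrow>
     (\<exists>R>0. \<exists>L>0. \<forall>t\<ge>T. \<forall>s\<in>{t - T..t}. \<forall>\<xi> \<in> cball (reference_trajectory f u x0 (t - T)) R.
        norm (flow f u s (t - T) \<xi>) \<le> L)"

definition output_differential ::
    "(real ^ 'nx \<Rightarrow> real ^ 'nu \<Rightarrow> real ^ 'ny) \<Rightarrow> real ^ 'nx \<Rightarrow> real ^ 'nu \<Rightarrow> real ^ 'nx ^ 'ny" where
  "output_differential h x v = jacobian (\<lambda>x. h x v) (at x)"

definition flow_differential ::
    "(real ^ 'nx \<Rightarrow> real ^ 'nu \<Rightarrow> real ^ 'nx) \<Rightarrow> (real \<Rightarrow> real ^ 'nu) \<Rightarrow>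
     real \<Rightarrow> real \<Rightarrow> real ^ 'nx \<Rightarrow> real ^ 'nx ^ 'nx" where
  "flow_differential f u s2 s1 \<xi> = jacobian (\<lambda>\<xi>. flow f u s2 s1 \<xi>) (at \<xi>)"

definition observability_grammian ::
    "(real ^ 'nx \<Rightarrow> real ^ 'nu \<Rightarrow> real ^ 'nx) \<Rightarrow> (real ^ 'nx \<Rightarrow> real ^ 'nu \<Rightarrow> real ^ 'ny) \<Rightarrow>
     (real \<Rightarrow> real ^ 'nu) \<Rightarrow> real ^ 'nx \<Rightarrow> real \<Rightarrow> real \<Rightarrow> real ^ 'nx ^ 'nx" where
  "observability_grammian f h u x0 t T =
     integral {t - T..t} (\<lambda>s.
       let x = reference_trajectory f u x0;
           \<Phi> = flow_differential f u s (t - T) (x (t - T));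
           H = output_differential h (x s) (u s)
       in transpose \<Phi> ** transpose H ** H ** \<Phi>)"

definition positive_semidefinite :: "real ^ 'n ^ 'n \<Rightarrow> bool" where
  "positive_semidefinite A \<longleftrightarrow> transpose A = A \<and> (\<forall>v. v \<bullet> (A *v v) \<ge> 0)"

definition loewner_ge :: "real ^ 'n ^ 'n \<Rightarrow> real ^ 'n ^ 'n \<Rightarrow> bool" (infix "\<succeq>" 50) where
  "A \<succeq> B \<longleftrightarrow> positive_semidefinite (A - B)"

end

theory Submission
  imports Defs
begin

text \<open>The boundedness assumption confines all flows involved, on windows of length \<open>T\<close>, to one compact
  convex set, so that the derivatives of \<open>f\<close> and \<open>h\<close> are bounded and Lipschitz there uniformly in the
  window. By Gronwall, output differences then agree with the linearized output \<open>H \<Phi> (\<xi>1 - \<xi>2)\<close> along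
  the reference trajectory up to an error \<open>C r |\<xi>1 - \<xi>2|\<close> for \<open>\<xi>1, \<xi>2\<close> in a ball of radius \<open>r\<close>, with
  \<open>C\<close> independent of the window. Since \<open>|p|\<^sup>2 \<ge> |q|\<^sup>2 / 2 - |p - q|\<^sup>2\<close>, for small \<open>r\<close> a quadratic lower
  bound for the cumulative output error and one for the Grammian imply each other.\<close>

text \<open>Persistence compares two arbitrary points of a ball, which may lie far closer to each
  other than to its centre. An error of order r^2 could then exceed the main term, so the remainder
  estimates are two-point estimates: their error carries the factor |\<xi>1 - \<xi>2|, and only the
  factor in front of it is made small. Two obstacles shape the rest. The Grammian contains the
  \<open>jacobian\<close> of the flow, which is an arbitrary choice unless the flow is
  differentiable in its initial value; this is not assumed and has to be derived for inputs that
  jump. Moreover \<open>integral\<close> has the default value 0 on functions that are not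
  integrable, so integrability on each window has to be established before any two integrals can be
  compared. In the converse direction the comparison reaches only short vectors; homogeneity of
  degree two of the Grammian form carries the bound to all vectors.\<close>

section \<open>Gronwall estimate with finitely many exceptional times\<close>

text \<open>The fundamental theorem of calculus tolerates finitely many points without a derivative
  if \<open>z\<close> is continuous. The integrand is set to 0 at these points, which keeps it
  nonpositive everywhere.\<close>

lemma decreasing_if_deriv_nonpos_off_finite:
  fixes z :: "real \<Rightarrow> real"
  assumes "finite S" "a \<le> b" "continuous_on {a..b} z"
    and der: "\<And>s. s \<in> {a<..<b} - S \<Longrightarrow> (z has_vector_derivative z' s) (at s)"
    and le: "\<And>s. s \<in> {a<..<b} - S \<Longrightarrow> z' s \<le> 0"
  shows "z b \<le> z a"
proof -
  define w where "w s = (if s \<in> {a<..<b} - S then z' s else 0)" for s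
  have "(w has_integral (z b - z a)) {a..b}"
    by (rule fundamental_theorem_of_calculus_interior_strong[OF assms(1,2) _ assms(3)])
      (use der in \<open>simp add: w_def\<close>)
  then have "z b - z a \<le> 0"
    by (rule has_integral_le[OF _ has_integral_0]) (use le in \<open>simp add: w_def\<close>)
  then show ?thesis by simp
qed

text \<open>The squared norm is used because the norm is not differentiable at 0. Adding
  \<open>c\<^sup>2\<close> to it makes the inequality homogeneous: 2 |y| c is at most |y|^2 + c^2,
  which accounts for the summand 1 in the rate \<open>2 * M + 1\<close>, and the weighted function
  \<open>z\<close> is then nonincreasing.\<close>

lemma Gronwall_off_finite:
  fixes y :: "real \<Rightarrow> 'a::real_inner"
  assumes "finite S" "continuous_on {a..b} y" "0 \<le> M"
    and der: "\<And>s. s \<in> {a<..<b} - S \<Longrightarrow> (y has_vector_derivative y' s) (at s)"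
    and bd: "\<And>s. s \<in> {a<..<b} - S \<Longrightarrow> norm (y' s) \<le> M * norm (y s) + c"
    and "0 \<le> c" and t: "t \<in> {a..b}"
  shows "norm (y t) \<le> exp ((2 * M + 1) * (b - a)) * (norm (y a) + c)"
proof -
  define k where "k = 2 * M + 1"
  define z where "z s = exp (- k * (s - a)) * (y s \<bullet> y s + c\<^sup>2)" for s
  define z' where "z' s = exp (- k * (s - a)) * (2 * (y s \<bullet> y' s) - k * (y s \<bullet> y s + c\<^sup>2))" for s
  have "z t \<le> z a"
  proof (rule decreasing_if_deriv_nonpos_off_finite[OF \<open>finite S\<close>, where z = z and a = a and b = t and z' = z'])
    show "a \<le> t" using t by simp
    have "continuous_on {a..t} y" using continuous_on_subset[OF assms(2)] t by simp
    then show "continuous_on {a..t} z" unfolding z_def by (intro continuous_on_mult continuous_intros)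
    fix s assume s: "s \<in> {a<..<t} - S"
    then have s': "s \<in> {a<..<b} - S" using t by auto
    have "(y has_derivative (\<lambda>h. h *\<^sub>R y' s)) (at s)"
      using der[OF s'] by (simp add: has_vector_derivative_def)
    then show "(z has_vector_derivative z' s) (at s)"
      unfolding z_def z'_def has_vector_derivative_def
      by (auto intro!: derivative_eq_intros ext simp: inner_commute algebra_simps)
    have "y s \<bullet> y' s \<le> norm (y s) * norm (y' s)" by (rule norm_cauchy_schwarz)
    also have "\<dots> \<le> norm (y s) * (M * norm (y s) + c)"
      using bd[OF s'] by (rule mult_left_mono) simp
    finally have "2 * (y s \<bullet> y' s) \<le> 2 * M * (norm (y s))\<^sup>2 + 2 * norm (y s) * c"
      by (simp add: power2_eq_square algebra_simps)
    also have "\<dots> \<le> 2 * M * (norm (y s))\<^sup>2 + ((norm (y s))\<^sup>2 + c\<^sup>2)"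
      using sum_squares_bound[of "norm (y s)" c] by simp
    also have "\<dots> \<le> k * ((norm (y s))\<^sup>2 + c\<^sup>2)"
      using \<open>0 \<le> M\<close> by (simp add: k_def algebra_simps)
    finally show "z' s \<le> 0"
      unfolding z'_def by (simp add: mult_nonneg_nonpos power2_norm_eq_inner)
  qed
  then have "exp (k * (t - a)) * z t \<le> exp (k * (t - a)) * z a"
    by simp
  then have "(norm (y t))\<^sup>2 + c\<^sup>2 \<le> exp (k * (t - a)) * ((norm (y a))\<^sup>2 + c\<^sup>2)"
    by (simp add: z_def power2_norm_eq_inner mult.assoc[symmetric] exp_add[symmetric])
  also have "\<dots> \<le> exp (k * (b - a)) * ((norm (y a))\<^sup>2 + c\<^sup>2)"
    using t \<open>0 \<le> M\<close> by (intro mult_right_mono) (auto simp: k_def intro!: mult_left_mono)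
  \<comment> \<open>The exponential is squared generously, so that taking the square root does not
    halve the rate.\<close>
  also have "\<dots> \<le> (exp (k * (b - a)))\<^sup>2 * (norm (y a) + c)\<^sup>2"
  proof (rule mult_mono)
    have "1 \<le> exp (k * (b - a))" using t \<open>0 \<le> M\<close> by (auto simp: k_def)
    then show "exp (k * (b - a)) \<le> (exp (k * (b - a)))\<^sup>2"
      by (simp add: power2_eq_square)
    show "(norm (y a))\<^sup>2 + c\<^sup>2 \<le> (norm (y a) + c)\<^sup>2"
      using \<open>0 \<le> c\<close> by (simp add: power2_sum)
  qed simp_all
  finally have "(norm (y t))\<^sup>2 \<le> (exp (k * (b - a)) * (norm (y a) + c))\<^sup>2"
    unfolding power_mult_distrib using zero_le_power2[of c] by linarith
  then show ?thesis
    using \<open>0 \<le> c\<close> by (auto intro: power2_le_imp_le simp: k_def)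
qed

section \<open>Uniform first-order estimates on compact sets\<close>

text \<open>\<open>D1\<close> and \<open>D2\<close> are continuous, hence bounded on the compact set
  \<open>B \<times> U\<close>. The last estimate linearizes the difference of two values at a third
  point \<open>x\<close>, later the reference state; its error is linear in \<open>y - z\<close>,
  with a factor that measures the distance to \<open>x\<close>.\<close>

lemma three_times_continuously_differentiable_bounds:
  fixes g :: "'x::euclidean_space \<Rightarrow> 'v::euclidean_space \<Rightarrow> 'y::real_normed_vector"
  assumes g: "three_times_continuously_differentiable (\<lambda>(x, v). g x v)"
    and B: "compact B" "convex B" and U: "compact U"
  obtains Dx M where "1 \<le> M"
    and "\<And>x v. ((\<lambda>x. g x v) has_derivative Dx x v) (at x)"
    and "continuous_on UNIV (\<lambda>(x, v). g x v)"
    and "\<And>w. continuous_on UNIV (\<lambda>(x, v). Dx x v w)"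
    and "\<And>x v w. x \<in> B \<Longrightarrow> v \<in> U \<Longrightarrow> norm (Dx x v w) \<le> M * norm w"
    and "\<And>x y v. x \<in> B \<Longrightarrow> y \<in> B \<Longrightarrow> v \<in> U \<Longrightarrow> norm (g y v - g x v) \<le> M * norm (y - x)"
    and "\<And>x y z v r. x \<in> B \<Longrightarrow> y \<in> B \<Longrightarrow> z \<in> B \<Longrightarrow> v \<in> U \<Longrightarrow> norm (y - x) \<le> r \<Longrightarrow> norm (z - x) \<le> r \<Longrightarrow>
           norm (g y v - g z v - Dx x v (y - z)) \<le> M * r * norm (y - z)"
proof -
  from g obtain D1 :: "'x \<times> 'v \<Rightarrow> ('x \<times> 'v) \<Rightarrow>\<^sub>L 'y" and D2 D3
    where D: "\<forall>z. ((\<lambda>(x, v). g x v) has_derivative blinfun_apply (D1 z)) (at z)"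
      "\<forall>z. (D1 has_derivative blinfun_apply (D2 z)) (at z)"
      "\<forall>z. (D2 has_derivative blinfun_apply (D3 z)) (at z)"
    unfolding three_times_continuously_differentiable_def by (elim exE conjE) (erule (2) that)
  note D1 = D(1)[rule_format] and D2 = D(2)[rule_format] and D3 = D(3)[rule_format]
  have cD1: "continuous_on S D1" for S
    by (intro continuous_at_imp_continuous_on ballI has_derivative_continuous[OF D2])
  have cD2: "continuous_on S D2" for S
    by (intro continuous_at_imp_continuous_on ballI has_derivative_continuous[OF D3])
  have K: "compact (B \<times> U)" using B U by (simp add: compact_Times)
  obtain M1 where M1: "\<And>z. z \<in> B \<times> U \<Longrightarrow> norm (D1 z) \<le> M1"
    using compact_imp_bounded[OF compact_continuous_image[OF cD1 K]]
    unfolding bounded_iff by blast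
  obtain M2 where M2: "\<And>z. z \<in> B \<times> U \<Longrightarrow> norm (D2 z) \<le> M2"
    using compact_imp_bounded[OF compact_continuous_image[OF cD2 K]]
    unfolding bounded_iff by blast
  define M where "M = max 1 (max M1 M2)"
  have M: "1 \<le> M" "M1 \<le> M" "M2 \<le> M" by (auto simp: M_def)
  define Dx where "Dx x v w = D1 (x, v) (w, 0)" for x v w
  have der: "((\<lambda>x. g x v) has_derivative Dx x v) (at x)" for x v
  proof -
    have "((\<lambda>x. (x, v)) has_derivative (\<lambda>w. (w, 0))) (at x)"
      by (auto intro!: derivative_eq_intros)
    from has_derivative_compose[OF this D1] show ?thesis
      by (simp add: Dx_def[abs_def])
  qed
  have bl: "bounded_linear (Dx x v)" for x v
    using der by (rule has_derivative_bounded_linear)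
  have Dxb: "norm (Dx x v w) \<le> M * norm w" if "x \<in> B" "v \<in> U" for x v w
  proof -
    have "norm (Dx x v w) \<le> norm (D1 (x, v)) * norm w"
      using norm_blinfun[of "D1 (x, v)" "(w, 0)"] by (simp add: Dx_def norm_Pair)
    also have "\<dots> \<le> M * norm w"
      using M1[of "(x, v)"] M that by (intro mult_right_mono) auto
    finally show ?thesis .
  qed
  have lip: "norm (g y v - g x v) \<le> M * norm (y - x)" if "x \<in> B" "y \<in> B" "v \<in> U" for x y v
    using that(1,2)
    by (intro differentiable_bound[OF \<open>convex B\<close> has_derivative_at_withinI[OF der]] onorm_le Dxb)
      (use that in auto)
  have D1lip: "norm (D1 (y, v) - D1 (x, v)) \<le> M * norm (y - x)"
    if "x \<in> B" "y \<in> B" "v \<in> U" for x y v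
  proof -
    have "norm (D1 (y, v) - D1 (x, v)) \<le> M * norm ((y, v) - (x, v))"
    \<comment> \<open>\<open>U\<close> need not be convex, so the mean value inequality is applied
      on a slice with fixed input \<open>v\<close>.\<close>
    proof (rule differentiable_bound[where S = "B \<times> {v}", OF _ has_derivative_at_withinI[OF D2]])
      show "convex (B \<times> {v})" using B by (simp add: convex_Times)
      fix z assume "z \<in> B \<times> {v}"
      then have "norm (D2 z) \<le> M" using M2[of z] M that by auto
      then show "onorm (blinfun_apply (D2 z)) \<le> M" by (simp add: norm_blinfun.rep_eq)
    qed (use that in auto)
    then show ?thesis by (simp add: norm_Pair)
  qed
  have rem: "norm (g y v - g z v - Dx x v (y - z)) \<le> M * r * norm (y - z)"
    if "x \<in> B" "y \<in> B" "z \<in> B" "v \<in> U" "norm (y - x) \<le> r" "norm (z - x) \<le> r" for x y z v r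
  proof -
    \<comment> \<open>The segment from \<open>z\<close> to \<open>y\<close> has to stay in
      \<open>B\<close>, where \<open>D1\<close> is Lipschitz, and within distance \<open>r\<close>
      of \<open>x\<close>; this intersection is convex and ensures both.\<close>
    let ?S = "B \<inter> cball x r"
    have cv: "convex ?S" using B by (simp add: convex_Int)
    have yz: "y \<in> ?S" "z \<in> ?S" using that by (auto simp: dist_norm norm_minus_commute)
    have r: "0 \<le> r" using that(5) norm_ge_zero order_trans by blast
    have "norm (g y v - g z v - Dx x v (y - z)) \<le> norm (y - z) * (M * r)"
    proof (rule differentiable_bound_linearization[where S = ?S and f = "\<lambda>x. g x v"
          and f' = "\<lambda>x. Dx x v"])
      fix t :: real assume "t \<in> {0..1}"
      then show "z + t *\<^sub>R (y - z) \<in> ?S"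
        using convexD_alt[OF cv yz(2,1), of t] by (simp add: algebra_simps)
    next
      fix p assume p: "p \<in> ?S"
      show "onorm (Dx p v - Dx x v) \<le> M * r"
      proof (rule onorm_le)
        fix w
        have "norm ((Dx p v - Dx x v) w) = norm ((D1 (p, v) - D1 (x, v)) (w, 0))"
          by (simp add: Dx_def blinfun.diff_left)
        also have "\<dots> \<le> norm (D1 (p, v) - D1 (x, v)) * norm w"
          using norm_blinfun[of "D1 (p, v) - D1 (x, v)" "(w, 0)"] by (simp add: norm_Pair)
        also have "\<dots> \<le> (M * r) * norm w"
        proof (rule mult_right_mono)
          have "norm (D1 (p, v) - D1 (x, v)) \<le> M * norm (p - x)"
            using D1lip[of x p v] p that by auto
          also have "\<dots> \<le> M * r"
            using p M by (intro mult_left_mono) (auto simp: dist_norm norm_minus_commute)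
          finally show "norm (D1 (p, v) - D1 (x, v)) \<le> M * r" .
        qed simp
        finally show "norm ((Dx p v - Dx x v) w) \<le> M * r * norm w" .
      qed
    qed (use r that in \<open>auto intro: has_derivative_at_withinI[OF der]\<close>)
    then show ?thesis by (simp add: mult.commute)
  qed
  have cg: "continuous_on UNIV (\<lambda>(x, v). g x v)"
    by (intro continuous_at_imp_continuous_on ballI has_derivative_continuous[OF D1])
  have cDx: "continuous_on UNIV (\<lambda>(x, v). Dx x v w)" for w
    unfolding Dx_def split_beta by (auto intro!: continuous_intros cD1)
  show thesis
    by (rule that[OF M(1) der cg cDx Dxb lip rem])
qed

section \<open>Approximate solutions of linear equations and derivatives of near-linear
  flows\<close>

text \<open>Perturbed solutions of the linear equation \<open>y' = A s (y s)\<close>: since the input may jump, the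
  equation is only required off the finite set \<open>S\<close>.\<close>

definition approx_linear_solution ::
    "(real \<Rightarrow> 'x \<Rightarrow> 'x) \<Rightarrow> real set \<Rightarrow> real \<Rightarrow> real \<Rightarrow> real \<Rightarrow> (real \<Rightarrow> 'x::real_inner) \<Rightarrow> bool" where
  "approx_linear_solution A S a b c y \<longleftrightarrow> continuous_on {a..b} y \<and>
     (\<exists>y'. \<forall>s\<in>{a<..<b} - S. (y has_vector_derivative y' s) (at s) \<and> norm (y' s - A s (y s)) \<le> c)"

lemma approx_linear_solution_add:
  assumes "\<And>s. s \<in> {a<..<b} - S \<Longrightarrow> linear (A s)"
    and "approx_linear_solution A S a b c y" "approx_linear_solution A S a b d z"
  shows "approx_linear_solution A S a b (c + d) (\<lambda>s. y s + z s)"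
proof -
  from assms obtain y' z' where
    y': "\<And>s. s\<in>{a<..<b} - S \<Longrightarrow> (y has_vector_derivative y' s) (at s) \<and> norm (y' s - A s (y s)) \<le> c"
    and z': "\<And>s. s\<in>{a<..<b} - S \<Longrightarrow> (z has_vector_derivative z' s) (at s) \<and> norm (z' s - A s (z s)) \<le> d"
    unfolding approx_linear_solution_def by metis
  have "norm (y' s + z' s - A s (y s + z s)) \<le> c + d" if "s \<in> {a<..<b} - S" for s
  proof -
    have "y' s + z' s - A s (y s + z s) = (y' s - A s (y s)) + (z' s - A s (z s))"
      using linear_add[OF assms(1)[OF that]] by simp
    then show ?thesis using y'[OF that] z'[OF that] norm_triangle_mono by metis
  qed
  then show ?thesis using assms(2,3) y' z' unfolding approx_linear_solution_def
    by (intro conjI continuous_intros exI[of _ "\<lambda>s. y' s + z' s"])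
      (auto intro!: has_vector_derivative_add)
qed

lemma approx_linear_solution_scale:
  assumes "\<And>s. s \<in> {a<..<b} - S \<Longrightarrow> linear (A s)" "approx_linear_solution A S a b c y"
  shows "approx_linear_solution A S a b (\<bar>k\<bar> * c) (\<lambda>s. k *\<^sub>R y s)"
proof -
  from assms obtain y' where
    y': "\<And>s. s\<in>{a<..<b} - S \<Longrightarrow> (y has_vector_derivative y' s) (at s) \<and> norm (y' s - A s (y s)) \<le> c"
    unfolding approx_linear_solution_def by metis
  have "norm (k *\<^sub>R y' s - A s (k *\<^sub>R y s)) \<le> \<bar>k\<bar> * c" if "s \<in> {a<..<b} - S" for s
  proof -
    have "k *\<^sub>R y' s - A s (k *\<^sub>R y s) = k *\<^sub>R (y' s - A s (y s))"
      using linear_scale[OF assms(1)[OF that]] by (simp add: scaleR_diff_right)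
    then show ?thesis using y'[OF that] by (simp add: mult_left_mono)
  qed
  then show ?thesis using assms(2) y' unfolding approx_linear_solution_def
    by (intro conjI continuous_intros exI[of _ "\<lambda>s. k *\<^sub>R y' s"])
      (auto intro: bounded_linear.has_vector_derivative[OF bounded_linear_scaleR_right])
qed

lemma approx_linear_solution_diff:
  assumes A: "\<And>s. s \<in> {a<..<b} - S \<Longrightarrow> linear (A s)"
    and "approx_linear_solution A S a b c y" "approx_linear_solution A S a b d z"
  shows "approx_linear_solution A S a b (c + d) (\<lambda>s. y s - z s)"
  using approx_linear_solution_add[OF A assms(2) approx_linear_solution_scale[OF A assms(3), where k = "-1"]]
  by simp

text \<open>With zero initial value, Gronwall leaves a multiple of the defect \<open>c\<close>.
  Applied to differences of approximate solutions with a common start, this plays the role of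
  uniqueness for the linear equation: defects that tend to 0 force equal limits.\<close>

lemma approx_linear_solution_bound:
  assumes "finite S" "0 \<le> M" "approx_linear_solution A S a b c y" "0 \<le> c" "y a = 0" "t \<in> {a..b}"
    and Ab: "\<And>s w. s \<in> {a<..<b} - S \<Longrightarrow> norm (A s w) \<le> M * norm w"
  shows "norm (y t) \<le> exp ((2 * M + 1) * (b - a)) * c"
proof -
  from assms obtain y' where
    y': "\<And>s. s\<in>{a<..<b} - S \<Longrightarrow> (y has_vector_derivative y' s) (at s) \<and> norm (y' s - A s (y s)) \<le> c"
    unfolding approx_linear_solution_def by metis
  have cont: "continuous_on {a..b} y"
    using assms(3) by (simp add: approx_linear_solution_def)
  have "norm (y' s) \<le> M * norm (y s) + c" if "s \<in> {a<..<b} - S" for s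
    using y'[OF that] Ab[OF that, of "y s"] norm_triangle_sub[of "y' s" "A s (y s)"] by simp
  from Gronwall_off_finite[OF assms(1) cont assms(2) conjunct1[OF y'] this \<open>0 \<le> c\<close> \<open>t \<in> {a..b}\<close>]
  show ?thesis using \<open>y a = 0\<close> by simp
qed

text \<open>Convergence of the difference quotients, linearity of the limit and the remainder
  estimate share one argument: the two sides are approximate solutions with the same value at
  \<open>a\<close>, so they differ by at most \<open>E\<close> times the sum of their
  defects.\<close>

lemma linearization_of_near_linear_flow:
  fixes \<phi> :: "real \<Rightarrow> 'x::euclidean_space \<Rightarrow> 'x"
  assumes "finite S" "0 \<le> M" "0 < R" "0 \<le> C"
    and lin: "\<And>s. s \<in> {a<..<b} - S \<Longrightarrow> linear (A s)"
    and Ab: "\<And>s w. s \<in> {a<..<b} - S \<Longrightarrow> norm (A s w) \<le> M * norm w"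
    and start: "\<And>\<xi>. \<xi> \<in> cball \<xi>0 R \<Longrightarrow> \<phi> a \<xi> = \<xi>"
    and approx: "\<And>r \<xi>1 \<xi>2. r \<le> R \<Longrightarrow> \<xi>1 \<in> cball \<xi>0 r \<Longrightarrow> \<xi>2 \<in> cball \<xi>0 r \<Longrightarrow>
      approx_linear_solution A S a b (C * r * norm (\<xi>1 - \<xi>2)) (\<lambda>s. \<phi> s \<xi>1 - \<phi> s \<xi>2)"
  obtains D where "\<And>s. s \<in> {a..b} \<Longrightarrow> (\<phi> s has_derivative D s) (at \<xi>0)"
    and "\<And>v. continuous_on {a..b} (\<lambda>s. D s v)"
    and "\<And>s r \<xi>1 \<xi>2. s \<in> {a..b} \<Longrightarrow> r \<le> R \<Longrightarrow> \<xi>1 \<in> cball \<xi>0 r \<Longrightarrow> \<xi>2 \<in> cball \<xi>0 r \<Longrightarrow>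
      norm (\<phi> s \<xi>1 - \<phi> s \<xi>2 - D s (\<xi>1 - \<xi>2)) \<le> exp ((2 * M + 1) * (b - a)) * (C * r * norm (\<xi>1 - \<xi>2))"
proof -
  define E where "E = exp ((2 * M + 1) * (b - a))"
  have E: "0 < E" by (simp add: E_def)
  have bnd: "norm (y t) \<le> E * c"
    if "approx_linear_solution A S a b c y" "0 \<le> c" "y a = 0" "t \<in> {a..b}" for y c t
    unfolding E_def by (rule approx_linear_solution_bound[OF assms(1,2) that Ab])
  \<comment> \<open>Existence theory for the variational equation is avoided: its solution is the limit of
    the difference quotients \<open>q n v\<close>, which solve it up to an error of order \<open>1 / n\<close>.\<close>
  define q where "q n v s = real n *\<^sub>R (\<phi> s (\<xi>0 + v /\<^sub>R real n) - \<phi> s \<xi>0)" for n v s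
  \<comment> \<open>The perturbed point is at distance |v|/n from \<xi>0, so the hypothesis with
    that radius gives a defect C (|v|/n)^2; multiplication by n in \<open>q\<close> leaves C |v|^2 /
    n.\<close>
  define c where "c v n = C * (norm v)\<^sup>2 / real n" for v :: 'x and n
  have c0: "0 \<le> c v n" for v n using \<open>0 \<le> C\<close> by (simp add: c_def)
  have clim: "(\<lambda>n. c v n) \<longlonglongrightarrow> 0" for v
    unfolding c_def by (rule lim_const_over_n)
  have "\<forall>\<^sub>F n in sequentially. approx_linear_solution A S a b (c v n) (q n v) \<and> q n v a = v" for v
    \<comment> \<open>Beyond this index the point \<open>\<xi>0 + v /\<^sub>R real n\<close> lies in
      the ball of radius \<open>R\<close>, and \<open>n\<close> is nonzero.\<close>
    using eventually_gt_at_top[of "nat \<lceil>norm v / R\<rceil>"]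
  proof eventually_elim
    case (elim n)
    then have n: "0 < n" and "norm v / R < real n" by linarith+
    then have r: "norm v / real n \<le> R" using \<open>0 < R\<close> by (simp add: field_simps)
    have in_r: "\<xi>0 + v /\<^sub>R real n \<in> cball \<xi>0 (norm v / real n)" "\<xi>0 \<in> cball \<xi>0 (norm v / real n)"
      by (auto simp: dist_norm divide_inverse mult.commute)
    have "approx_linear_solution A S a b
       (\<bar>real n\<bar> * (C * (norm v / real n) * norm (\<xi>0 + v /\<^sub>R real n - \<xi>0))) (q n v)"
      unfolding q_def by (intro approx_linear_solution_scale lin approx r in_r)
    moreover have "\<bar>real n\<bar> * (C * (norm v / real n) * norm (\<xi>0 + v /\<^sub>R real n - \<xi>0)) = c v n"
      using n by (simp add: c_def power2_eq_square field_simps)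
    moreover have "q n v a = v"
    proof -
      have "\<phi> a (\<xi>0 + v /\<^sub>R real n) = \<xi>0 + v /\<^sub>R real n" "\<phi> a \<xi>0 = \<xi>0"
        using in_r r \<open>0 < R\<close> by (auto intro!: start)
      then show ?thesis using n by (simp add: q_def)
    qed
    ultimately show ?case by simp
  qed
  then have qapp: "\<forall>\<^sub>F n in sequentially. approx_linear_solution A S a b (c v n) (q n v)"
    and q0: "\<forall>\<^sub>F n in sequentially. q n v a = v" for v
    unfolding eventually_conj_iff by blast+
  have "\<exists>l. uniform_limit {a..b} (\<lambda>n. q n v) l sequentially" for v
  proof -
    have "uniformly_Cauchy_on {a..b} (\<lambda>n. q n v)"
    proof (rule uniformly_Cauchy_onI')
      fix e :: real assume "0 < e"
      have "(\<lambda>n. E * (c v n + c v n)) \<longlonglongrightarrow> E * (0 + 0)"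
        by (intro tendsto_intros clim)
      then have "\<forall>\<^sub>F n in sequentially. E * (c v n + c v n) < e"
        using \<open>0 < e\<close> by (intro order_tendstoD) auto
      with qapp[of v] q0[of v] eventually_gt_at_top[of 0]
      have "\<forall>\<^sub>F n in sequentially. approx_linear_solution A S a b (c v n) (q n v) \<and> q n v a = v
        \<and> E * (c v n + c v n) < e \<and> 0 < n"
        by eventually_elim auto
      then obtain N where N: "\<And>n. n \<ge> N \<Longrightarrow> approx_linear_solution A S a b (c v n) (q n v) \<and> q n v a = v
        \<and> E * (c v n + c v n) < e \<and> 0 < n"
        unfolding eventually_sequentially by blast
      have "dist (q m v s) (q n v s) < e" if "s \<in> {a..b}" "N \<le> m" "m < n" for s m n
      proof -
        have "norm (q m v s - q n v s) \<le> E * (c v m + c v n)"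
        proof (rule bnd[where y = "\<lambda>s. q m v s - q n v s", OF approx_linear_solution_diff[OF lin]])
          show "approx_linear_solution A S a b (c v m) (q m v)"
            "approx_linear_solution A S a b (c v n) (q n v)" "q m v a - q n v a = 0"
            using N[of m] N[of n] that by simp_all
        qed (use that c0 in simp_all)
        also have "\<dots> \<le> E * (c v m + c v m)"
          using that N[of m] \<open>0 \<le> C\<close> E unfolding c_def
          by (intro mult_left_mono add_left_mono divide_left_mono) auto
        also have "\<dots> < e" using N[of m] that by auto
        finally show ?thesis by (simp add: dist_norm)
      qed
      then show "\<exists>N. \<forall>s\<in>{a..b}. \<forall>m\<ge>N. \<forall>n>m. dist (q m v s) (q n v s) < e" by blast
    qed
    then show ?thesis
      using Cauchy_uniformly_convergent uniformly_convergent_on_def by blast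
  qed
  then obtain l where l: "\<And>v. uniform_limit {a..b} (\<lambda>n. q n v) (l v) sequentially" by metis
  define D where "D s v = l v s" for s v
  have lim: "(\<lambda>n. q n v s) \<longlonglongrightarrow> D s v" if "s \<in> {a..b}" for s v
    unfolding D_def using tendsto_uniform_limitI[OF l that] .
  \<comment> \<open>This is why uniform convergence in time is established: the continuity passes to
    the limit and is needed for the integrability of the linearized output.\<close>
  have cont: "continuous_on {a..b} (\<lambda>s. D s v)" for v
    unfolding D_def
  proof (rule uniform_limit_theorem[OF _ l])
    show "\<forall>\<^sub>F n in sequentially. continuous_on {a..b} (q n v)"
      using qapp[of v] by (rule eventually_mono) (simp add: approx_linear_solution_def)
  qed simp
  \<comment> \<open>The Gronwall bound passes to pointwise limits, so properties of \<open>D\<close>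
    are read off from the quotients without showing that \<open>D\<close> itself solves a
    differential equation.\<close>
  have bnd_lim: "norm Y \<le> E * k"
    if "t \<in> {a..b}" "(\<lambda>n. y n t) \<longlonglongrightarrow> Y" "k' \<longlonglongrightarrow> k"
      and "\<forall>\<^sub>F n in sequentially. approx_linear_solution A S a b (k' n) (y n) \<and> 0 \<le> k' n \<and> y n a = 0"
    for t y Y and k :: real and k'
  proof (rule tendsto_le[OF _ _ tendsto_norm[OF that(2)]])
    show "(\<lambda>n. E * k' n) \<longlonglongrightarrow> E * k" by (intro tendsto_intros that)
    show "\<forall>\<^sub>F n in sequentially. norm (y n t) \<le> E * k' n"
      using that(4) by (rule eventually_mono) (use bnd that(1) in blast)
  qed simp
  have linD: "linear (D s)" if s: "s \<in> {a..b}" for s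
  proof (rule linearI)
    fix v w
    \<comment> \<open>One zero for each of the three quotients involved, whose defects all vanish in
      the limit; the bound is therefore an equality in disguise.\<close>
    have "norm (D s (v + w) - D s v - D s w) \<le> E * (0 + 0 + 0)"
    proof (rule bnd_lim[OF s, where y = "\<lambda>n s. q n (v + w) s - q n v s - q n w s"])
      show "(\<lambda>n. c (v + w) n + c v n + c w n) \<longlonglongrightarrow> 0 + 0 + 0"
        by (intro tendsto_intros clim)
      show "\<forall>\<^sub>F n in sequentially. approx_linear_solution A S a b (c (v + w) n + c v n + c w n)
              (\<lambda>s. q n (v + w) s - q n v s - q n w s)
            \<and> 0 \<le> c (v + w) n + c v n + c w n \<and> q n (v + w) a - q n v a - q n w a = 0"
        using qapp[of "v + w"] qapp[of v] qapp[of w] q0[of "v + w"] q0[of v] q0[of w]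
        by eventually_elim (use c0 in \<open>auto intro!: approx_linear_solution_diff[OF lin]\<close>)
    qed (intro tendsto_intros lim s)
    then show "D s (v + w) = D s v + D s w" by (simp add: algebra_simps)
  next
    fix k v
    have "norm (D s (k *\<^sub>R v) - k *\<^sub>R D s v) \<le> E * (0 + \<bar>k\<bar> * 0)"
    proof (rule bnd_lim[OF s, where y = "\<lambda>n s. q n (k *\<^sub>R v) s - k *\<^sub>R q n v s"])
      show "(\<lambda>n. c (k *\<^sub>R v) n + \<bar>k\<bar> * c v n) \<longlonglongrightarrow> 0 + \<bar>k\<bar> * 0"
        by (intro tendsto_intros clim)
      show "\<forall>\<^sub>F n in sequentially. approx_linear_solution A S a b (c (k *\<^sub>R v) n + \<bar>k\<bar> * c v n)
              (\<lambda>s. q n (k *\<^sub>R v) s - k *\<^sub>R q n v s)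
            \<and> 0 \<le> c (k *\<^sub>R v) n + \<bar>k\<bar> * c v n \<and> q n (k *\<^sub>R v) a - k *\<^sub>R q n v a = 0"
        using qapp[of "k *\<^sub>R v"] qapp[of v] q0[of "k *\<^sub>R v"] q0[of v]
        by eventually_elim
          (use c0 in \<open>auto intro!: approx_linear_solution_diff[OF lin] approx_linear_solution_scale[OF lin]\<close>)
    qed (intro tendsto_intros lim s)
    then show "D s (k *\<^sub>R v) = k *\<^sub>R D s v" by simp
  qed
  have rem: "norm (\<phi> s \<xi>1 - \<phi> s \<xi>2 - D s (\<xi>1 - \<xi>2)) \<le> E * (C * r * norm (\<xi>1 - \<xi>2))"
    if s: "s \<in> {a..b}" and r: "r \<le> R" "\<xi>1 \<in> cball \<xi>0 r" "\<xi>2 \<in> cball \<xi>0 r" for s r \<xi>1 \<xi>2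
  proof -
    define k where "k = C * r * norm (\<xi>1 - \<xi>2)"
    have "0 \<le> r" using r(2) zero_le_dist order_trans by (metis mem_cball)
    then have k: "0 \<le> k" using \<open>0 \<le> C\<close> by (simp add: k_def)
    have app: "approx_linear_solution A S a b k (\<lambda>s. \<phi> s \<xi>1 - \<phi> s \<xi>2)"
      unfolding k_def by (rule approx[OF r])
    have st: "\<phi> a \<xi>1 - \<phi> a \<xi>2 = \<xi>1 - \<xi>2" using r by (simp add: start)
    \<comment> \<open>The difference of the two flows and the quotients in direction
      \<open>\<xi>1 - \<xi>2\<close> have the same start. Only the defect \<open>k\<close> of the
      former survives the limit.\<close>
    have "norm (\<phi> s \<xi>1 - \<phi> s \<xi>2 - D s (\<xi>1 - \<xi>2)) \<le> E * (k + 0)"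
    proof (rule bnd_lim[OF s, where y = "\<lambda>n s. \<phi> s \<xi>1 - \<phi> s \<xi>2 - q n (\<xi>1 - \<xi>2) s"])
      show "(\<lambda>n. k + c (\<xi>1 - \<xi>2) n) \<longlonglongrightarrow> k + 0"
        by (intro tendsto_intros clim)
      show "\<forall>\<^sub>F n in sequentially. approx_linear_solution A S a b (k + c (\<xi>1 - \<xi>2) n)
              (\<lambda>s. \<phi> s \<xi>1 - \<phi> s \<xi>2 - q n (\<xi>1 - \<xi>2) s)
            \<and> 0 \<le> k + c (\<xi>1 - \<xi>2) n \<and> \<phi> a \<xi>1 - \<phi> a \<xi>2 - q n (\<xi>1 - \<xi>2) a = 0"
        using qapp[of "\<xi>1 - \<xi>2"] q0[of "\<xi>1 - \<xi>2"]
        by eventually_elim (use c0 k st app in \<open>auto intro!: approx_linear_solution_diff[OF lin]\<close>)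
    qed (intro tendsto_intros lim s)
    then show ?thesis by (simp add: k_def)
  qed
  have der: "(\<phi> s has_derivative D s) (at \<xi>0)" if s: "s \<in> {a..b}" for s
    unfolding has_derivative_at_alt
  proof (intro conjI allI impI)
    show "bounded_linear (D s)" using linD[OF s] by (simp add: linear_conv_bounded_linear)
    fix e :: real assume "0 < e"
    \<comment> \<open>The summand 1 covers the case \<open>C = 0\<close>. Below, the remainder is
      used with radius \<open>norm (y - \<xi>0)\<close>, which makes it quadratic.\<close>
    define d where "d = min R (e / (E * C + 1))"
    have pos: "0 < E * C + 1" using E \<open>0 \<le> C\<close> by (simp add: add_nonneg_pos)
    have "0 < d" using \<open>0 < e\<close> \<open>0 < R\<close> pos by (simp add: d_def)
    moreover have "norm (\<phi> s y - \<phi> s \<xi>0 - D s (y - \<xi>0)) \<le> e * norm (y - \<xi>0)"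
      if y: "norm (y - \<xi>0) < d" for y
    proof -
      have "norm (\<phi> s y - \<phi> s \<xi>0 - D s (y - \<xi>0)) \<le> E * (C * norm (y - \<xi>0) * norm (y - \<xi>0))"
        using y by (intro rem[OF s]) (auto simp: d_def dist_norm norm_minus_commute)
      also have "\<dots> \<le> ((E * C + 1) * norm (y - \<xi>0)) * norm (y - \<xi>0)"
        by (simp add: algebra_simps)
      also have "\<dots> \<le> e * norm (y - \<xi>0)"
        using y pos by (intro mult_right_mono) (simp_all add: d_def field_simps)
      finally show ?thesis .
    qed
    ultimately show "\<exists>d>0. \<forall>y. norm (y - \<xi>0) < d \<longrightarrow>
        norm (\<phi> s y - \<phi> s \<xi>0 - D s (y - \<xi>0)) \<le> e * norm (y - \<xi>0)" by blast
  qed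
  show thesis
    by (rule that[OF der cont rem[unfolded E_def]])
qed

section \<open>The flow of the system and its linearization\<close>

text \<open>Uniqueness makes the description in \<open>flow\<close> well defined, but only for times
  from the start onwards, since solutions are unconstrained before it.\<close>

lemma flow_eq_solution:
  assumes "solutions_uniquely_defined f U" "input_trajectory U u" "0 \<le> a"
    and "is_solution f u a \<xi> x" "a \<le> s"
  shows "flow f u s a \<xi> = x s"
proof -
  have uniq: "y s = x s" if "is_solution f u a \<xi> y" for y
    using assms(1)[unfolded solutions_uniquely_defined_def, rule_format, OF assms(2,3)]
      that assms(4,5) by metis
  show ?thesis
    unfolding flow_def
  proof (rule the_equality)
    show "\<exists>y. is_solution f u a \<xi> y \<and> y s = x s" using assms(4) by auto
  next
    fix z assume "\<exists>y. is_solution f u a \<xi> y \<and> y s = z"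
    then show "z = x s" using uniq by auto
  qed
qed

lemma flow_is_solution:
  assumes "solutions_uniquely_defined f U" "input_trajectory U u" "0 \<le> a"
  shows "is_solution f u a \<xi> (\<lambda>s. flow f u s a \<xi>)"
proof -
  obtain x where x: "is_solution f u a \<xi> x"
    using assms(1)[unfolded solutions_uniquely_defined_def, rule_format, OF assms(2,3)] by metis
  have eq: "\<And>s. s \<in> {a..} \<Longrightarrow> flow f u s a \<xi> = x s"
    using flow_eq_solution[OF assms x] by simp
  show ?thesis
    unfolding is_solution_def
  proof (intro conjI allI impI)
    show "flow f u a a \<xi> = \<xi>" using x eq by (simp add: is_solution_def)
    show "continuous_on {a..} (\<lambda>s. flow f u s a \<xi>)"
      using x continuous_on_cong[of "{a..}" "{a..}" "\<lambda>s. flow f u s a \<xi>" x] eq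
      unfolding is_solution_def by blast
    fix t assume t: "a \<le> t" "continuous (at t within {0..}) u"
    have "(x has_vector_derivative f (x t) (u t)) (at t within {a..})"
      using x t by (simp add: is_solution_def)
    then show "((\<lambda>s. flow f u s a \<xi>) has_vector_derivative f (flow f u t a \<xi>) (u t)) (at t within {a..})"
      using t eq by (auto intro: has_vector_derivative_transform)
  qed
qed

text \<open>A solution restricted to a later start is again a solution, because one-sided
  derivatives within a larger half-line restrict to a smaller one. This identifies the reference
  trajectory on a window with the flow from its state at the left end.\<close>

lemma flow_flow:
  assumes "solutions_uniquely_defined f U" "input_trajectory U u" "0 \<le> a" "a \<le> s"
  shows "flow f u s a (flow f u a 0 \<xi>) = flow f u s 0 \<xi>"
proof (rule flow_eq_solution[OF assms(1-3) _ assms(4), where x = "\<lambda>s. flow f u s 0 \<xi>"])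
  have "is_solution f u 0 \<xi> (\<lambda>s. flow f u s 0 \<xi>)"
    by (rule flow_is_solution[OF assms(1,2)]) simp
  then show "is_solution f u a (flow f u a 0 \<xi>) (\<lambda>s. flow f u s 0 \<xi>)"
    unfolding is_solution_def using assms(3)
    by (auto elim!: continuous_on_subset intro: has_vector_derivative_within_subset[where S = "{0..}"])
qed

lemma flow_initial:
  assumes "solutions_uniquely_defined f U" "input_trajectory U u" "0 \<le> a"
  shows "flow f u a a \<xi> = \<xi>"
  using flow_is_solution[OF assms] by (simp add: is_solution_def)

lemma continuous_on_flow:
  assumes "solutions_uniquely_defined f U" "input_trajectory U u" "0 \<le> a"
  shows "continuous_on {a..b} (\<lambda>s. flow f u s a \<xi>)"
  using flow_is_solution[OF assms, of \<xi>] unfolding is_solution_def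
  by (auto intro: continuous_on_subset)

lemma flow_has_vector_derivative:
  assumes "solutions_uniquely_defined f U" "input_trajectory U u" "0 \<le> a"
    and "a < s" "continuous (at s within {0..}) u"
  shows "((\<lambda>s. flow f u s a \<xi>) has_vector_derivative f (flow f u s a \<xi>) (u s)) (at s)"
proof -
  have "((\<lambda>s. flow f u s a \<xi>) has_vector_derivative f (flow f u s a \<xi>) (u s)) (at s within {a..})"
    using flow_is_solution[OF assms(1-3), of \<xi>] assms(4,5) by (simp add: is_solution_def)
  moreover have "at s within {a..} = at s"
    using \<open>a < s\<close> by (intro at_within_interior) simp
  ultimately show ?thesis by simp
qed

text \<open>Gronwall enters twice. With \<open>c = 0\<close> it shows that the flow is Lipschitz in
  its initial value with constant \<open>E\<close>. Hence states remain within \<open>E * r\<close>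
  of the reference, and the difference of two flows solves the linear equation with defect
  \<open>M * (E * r) * (E * norm (\<xi>1 - \<xi>2))\<close>; the second application turns this
  defect into the remainder and adds the outer factor \<open>E\<close>.\<close>

lemma flow_linearization:
  fixes f :: "real ^ 'nx \<Rightarrow> real ^ 'nu \<Rightarrow> real ^ 'nx"
  assumes sol: "solutions_uniquely_defined f U" "input_trajectory U u" "0 \<le> a"
    and "0 < R" "0 \<le> M"
    and bounded: "\<And>s \<xi>. s \<in> {a..b} \<Longrightarrow> \<xi> \<in> cball \<xi>0 R \<Longrightarrow> flow f u s a \<xi> \<in> B"
    and der: "\<And>x v. ((\<lambda>x. f x v) has_derivative Dx x v) (at x)"
    and Dxb: "\<And>x v w. x \<in> B \<Longrightarrow> v \<in> U \<Longrightarrow> norm (Dx x v w) \<le> M * norm w"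
    and lip: "\<And>x y v. x \<in> B \<Longrightarrow> y \<in> B \<Longrightarrow> v \<in> U \<Longrightarrow> norm (f y v - f x v) \<le> M * norm (y - x)"
    and rem: "\<And>x y z v r. x \<in> B \<Longrightarrow> y \<in> B \<Longrightarrow> z \<in> B \<Longrightarrow> v \<in> U \<Longrightarrow>
       norm (y - x) \<le> r \<Longrightarrow> norm (z - x) \<le> r \<Longrightarrow>
       norm (f y v - f z v - Dx x v (y - z)) \<le> M * r * norm (y - z)"
    and E: "E = exp ((2 * M + 1) * (b - a))"
  obtains D where "\<And>s. s \<in> {a..b} \<Longrightarrow> (flow f u s a has_derivative D s) (at \<xi>0)"
    and "\<And>v. continuous_on {a..b} (\<lambda>s. D s v)"
    and "\<And>s r \<xi>1 \<xi>2. s \<in> {a..b} \<Longrightarrow> r \<le> R \<Longrightarrow> \<xi>1 \<in> cball \<xi>0 r \<Longrightarrow> \<xi>2 \<in> cball \<xi>0 r \<Longrightarrow>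
      norm (flow f u s a \<xi>1 - flow f u s a \<xi>2 - D s (\<xi>1 - \<xi>2)) \<le> E * (M * E * E * r * norm (\<xi>1 - \<xi>2))"
    and "\<And>s \<xi>1 \<xi>2. s \<in> {a..b} \<Longrightarrow> \<xi>1 \<in> cball \<xi>0 R \<Longrightarrow> \<xi>2 \<in> cball \<xi>0 R \<Longrightarrow>
      norm (flow f u s a \<xi>1 - flow f u s a \<xi>2) \<le> E * norm (\<xi>1 - \<xi>2)"
proof -
  define S where "S = {t \<in> {0..b}. \<not> continuous (at t within {0..}) u}"
  have S: "finite S"
    using sol(2) by (simp add: S_def input_trajectory_def piecewise_continuous_def)
  have E0: "0 < E" using E by simp
  have uU: "u s \<in> U" if "a \<le> s" for s
    using sol(2,3) that by (simp add: input_trajectory_def)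
  have vd: "((\<lambda>s. flow f u s a \<xi>) has_vector_derivative f (flow f u s a \<xi>) (u s)) (at s)"
    if "s \<in> {a<..<b} - S" for s \<xi>
    using that sol(3) by (intro flow_has_vector_derivative[OF sol]) (auto simp: S_def)
  have cont: "continuous_on {a..b} (\<lambda>s. flow f u s a \<xi>1 - flow f u s a \<xi>2)" for \<xi>1 \<xi>2
    by (intro continuous_intros continuous_on_flow[OF sol])
  have vd': "((\<lambda>s. flow f u s a \<xi>1 - flow f u s a \<xi>2) has_vector_derivative
      f (flow f u s a \<xi>1) (u s) - f (flow f u s a \<xi>2) (u s)) (at s)"
    if "s \<in> {a<..<b} - S" for s \<xi>1 \<xi>2
    by (intro has_vector_derivative_diff vd that)
  have lipflow: "norm (flow f u s a \<xi>1 - flow f u s a \<xi>2) \<le> E * norm (\<xi>1 - \<xi>2)"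
    if "s \<in> {a..b}" "\<xi>1 \<in> cball \<xi>0 R" "\<xi>2 \<in> cball \<xi>0 R" for s \<xi>1 \<xi>2
  proof -
    have "norm (f (flow f u s a \<xi>1) (u s) - f (flow f u s a \<xi>2) (u s))
        \<le> M * norm (flow f u s a \<xi>1 - flow f u s a \<xi>2) + 0" if "s \<in> {a<..<b} - S" for s
      using that \<open>\<xi>1 \<in> cball \<xi>0 R\<close> \<open>\<xi>2 \<in> cball \<xi>0 R\<close> lip bounded uU by simp
    from Gronwall_off_finite[OF S cont \<open>0 \<le> M\<close> vd' this order_refl that(1)]
    show ?thesis by (simp add: E flow_initial[OF sol])
  qed
  have x0: "\<xi>0 \<in> cball \<xi>0 r" if "0 \<le> r" for r using that by simp
  have flB: "flow f u s a \<xi>0 \<in> B" if "s \<in> {a..b}" for s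
    using bounded[OF that] x0 \<open>0 < R\<close> by simp
  \<comment> \<open>The coefficient of the variational equation along the solution from the centre
    \<open>\<xi>0\<close>.\<close>
  define A where "A s = Dx (flow f u s a \<xi>0) (u s)" for s
  have lin: "linear (A s)" for s
    unfolding A_def using der has_derivative_linear by blast
  have Ab: "norm (A s w) \<le> M * norm w" if "s \<in> {a<..<b} - S" for s w
    unfolding A_def using that by (intro Dxb flB uU) auto
  have approx: "approx_linear_solution A S a b (M * E * E * r * norm (\<xi>1 - \<xi>2))
      (\<lambda>s. flow f u s a \<xi>1 - flow f u s a \<xi>2)"
    if r: "r \<le> R" and \<xi>: "\<xi>1 \<in> cball \<xi>0 r" "\<xi>2 \<in> cball \<xi>0 r" for r \<xi>1 \<xi>2
  proof -
    have r0: "0 \<le> r" using \<xi>(1) by (meson mem_cball order_trans zero_le_dist)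
    have \<xi>R: "\<xi>1 \<in> cball \<xi>0 R" "\<xi>2 \<in> cball \<xi>0 R" using r \<xi> by auto
    have near: "norm (flow f u s a \<xi> - flow f u s a \<xi>0) \<le> E * r"
      if "s \<in> {a..b}" "\<xi> \<in> cball \<xi>0 r" for s \<xi>
    proof -
      have "norm (flow f u s a \<xi> - flow f u s a \<xi>0) \<le> E * norm (\<xi> - \<xi>0)"
        using that r x0 \<open>0 < R\<close> by (intro lipflow) auto
      also have "\<dots> \<le> E * r"
        using that E0 by (simp add: dist_norm norm_minus_commute)
      finally show ?thesis .
    qed
    have "norm (f (flow f u s a \<xi>1) (u s) - f (flow f u s a \<xi>2) (u s) - A s (flow f u s a \<xi>1 - flow f u s a \<xi>2))
        \<le> M * E * E * r * norm (\<xi>1 - \<xi>2)" if "s \<in> {a<..<b} - S" for s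
    proof -
      have s: "s \<in> {a..b}" using that by simp
      have "norm (f (flow f u s a \<xi>1) (u s) - f (flow f u s a \<xi>2) (u s) - A s (flow f u s a \<xi>1 - flow f u s a \<xi>2))
         \<le> M * (E * r) * norm (flow f u s a \<xi>1 - flow f u s a \<xi>2)"
        unfolding A_def using s by (intro rem near \<xi> flB bounded[OF _ \<xi>R(1)] bounded[OF _ \<xi>R(2)] uU) auto
      also have "\<dots> \<le> M * (E * r) * (E * norm (\<xi>1 - \<xi>2))"
        using \<open>0 \<le> M\<close> E0 r0 by (intro mult_left_mono lipflow[OF s \<xi>R]) auto
      finally show ?thesis by (simp add: mult_ac)
    qed
    then show ?thesis
      unfolding approx_linear_solution_def
      by (intro conjI cont exI[of _ "\<lambda>s. f (flow f u s a \<xi>1) (u s) - f (flow f u s a \<xi>2) (u s)"] ballI)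
        (simp_all add: vd')
  qed
  have C: "0 \<le> M * E * E" using \<open>0 \<le> M\<close> E0 by simp
  show thesis
  proof (rule linearization_of_near_linear_flow[where \<phi> = "\<lambda>s. flow f u s a" and a = a and b = b
        and ?\<xi>0.0 = \<xi>0 and R = R, OF S \<open>0 \<le> M\<close> \<open>0 < R\<close> C lin Ab flow_initial[OF sol] approx, folded E])
    fix D
    assume D: "\<And>s. s \<in> {a..b} \<Longrightarrow> (flow f u s a has_derivative D s) (at \<xi>0)"
      "\<And>v. continuous_on {a..b} (\<lambda>s. D s v)"
      "\<And>s r \<xi>1 \<xi>2. s \<in> {a..b} \<Longrightarrow> r \<le> R \<Longrightarrow> \<xi>1 \<in> cball \<xi>0 r \<Longrightarrow> \<xi>2 \<in> cball \<xi>0 r \<Longrightarrow>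
        norm (flow f u s a \<xi>1 - flow f u s a \<xi>2 - D s (\<xi>1 - \<xi>2)) \<le> E * (M * E * E * r * norm (\<xi>1 - \<xi>2))"
    show thesis by (rule that[OF D lipflow])
  qed
qed

section \<open>Integrability and the linearized output on a window\<close>

text \<open>Off a null set the function is continuous, hence measurable, and it is dominated by a
  constant; values on the null set do not matter.\<close>

lemma integrable_on_bounded_continuous_off_finite:
  fixes g :: "real \<Rightarrow> 'b::euclidean_space"
  assumes "finite S" "continuous_on ({a..b} - S) g" "\<And>s. s \<in> {a..b} - S \<Longrightarrow> norm (g s) \<le> K"
  shows "g integrable_on {a..b}"
proof -
  have S: "negligible S" using \<open>finite S\<close> by (rule negligible_finite)
  have leb: "{a..b} - S \<in> sets lebesgue" using negligible_imp_sets[OF S] by auto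
  have "(\<lambda>_. K) integrable_on {a..b}" by (rule integrable_const_ivl)
  then have "(\<lambda>_. K) integrable_on {a..b} - S"
    by (rule integrable_spike_set) (auto intro: negligible_subset[OF S])
  then have "g integrable_on {a..b} - S"
    by (intro measurable_bounded_by_integrable_imp_integrable[OF _ _ assms(3) leb]
        continuous_imp_measurable_on_sets_lebesgue assms(2) leb)
  then show ?thesis
    by (rule integrable_spike_set) (auto intro: negligible_subset[OF S])
qed

text \<open>\<open>jacobian\<close> is built on a chosen derivative, so it carries information only
  once some derivative is known; uniqueness then identifies the choice.\<close>

lemma jacobian_mult_vec:
  fixes g :: "real ^ 'n \<Rightarrow> real ^ 'm"
  assumes "(g has_derivative g') (at x)"
  shows "jacobian g (at x) *v v = g' v"
  using frechet_derivative_at[OF assms] has_derivative_linear[OF assms]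
  by (simp add: jacobian_def matrix_works)

text \<open>Treating the product as a single matrix N exhibits the integrand of the Grammian as
  \<open>transpose N ** N\<close>.\<close>

definition linearized_output ::
    "(real ^ 'nx \<Rightarrow> real ^ 'nu \<Rightarrow> real ^ 'nx) \<Rightarrow> (real ^ 'nx \<Rightarrow> real ^ 'nu \<Rightarrow> real ^ 'ny) \<Rightarrow>
     (real \<Rightarrow> real ^ 'nu) \<Rightarrow> real ^ 'nx \<Rightarrow> real \<Rightarrow> real \<Rightarrow> real ^ 'nx ^ 'ny" where
  "linearized_output f h u x0 a s =
     output_differential h (reference_trajectory f u x0 s) (u s) **
     flow_differential f u s a (reference_trajectory f u x0 a)"

text \<open>The radius and the constant are fixed before \<open>t\<close>: the bound
  \<open>L\<close>, the derivative bounds on the ball of radius \<open>L\<close> and the window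
  length \<open>T\<close> are common to all windows. The derivative of the flow depends on the
  window, but its error constants do not.\<close>

lemma output_linearization:
  fixes f :: "real ^ 'nx \<Rightarrow> real ^ 'nu \<Rightarrow> real ^ 'nx"
    and h :: "real ^ 'nx \<Rightarrow> real ^ 'nu \<Rightarrow> real ^ 'ny"
  assumes sol: "solutions_uniquely_defined f U"
    and f: "three_times_continuously_differentiable (\<lambda>(x, v). f x v)"
    and h: "three_times_continuously_differentiable (\<lambda>(x, v). h x v)"
    and U: "compact U" and u: "input_trajectory U u"
    and rb: "regularly_bounded f u x0 T" and "0 < T"
  obtains R C where "0 < R" "0 \<le> C"
    and "\<And>t s r \<xi>1 \<xi>2. T \<le> t \<Longrightarrow> s \<in> {t - T..t} \<Longrightarrow> r \<le> R \<Longrightarrow>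
      \<xi>1 \<in> cball (reference_trajectory f u x0 (t - T)) r \<Longrightarrow>
      \<xi>2 \<in> cball (reference_trajectory f u x0 (t - T)) r \<Longrightarrow>
      norm (h (flow f u s (t - T) \<xi>1) (u s) - h (flow f u s (t - T) \<xi>2) (u s)
        - linearized_output f h u x0 (t - T) s *v (\<xi>1 - \<xi>2)) \<le> C * r * norm (\<xi>1 - \<xi>2)"
    and "\<And>t \<xi>1 \<xi>2. T \<le> t \<Longrightarrow>
      \<xi>1 \<in> cball (reference_trajectory f u x0 (t - T)) R \<Longrightarrow>
      \<xi>2 \<in> cball (reference_trajectory f u x0 (t - T)) R \<Longrightarrow>
      (\<lambda>s. (norm (h (flow f u s (t - T) \<xi>1) (u s) - h (flow f u s (t - T) \<xi>2) (u s)))\<^sup>2)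
        integrable_on {t - T..t}"
    and "\<And>t v w. T \<le> t \<Longrightarrow>
      (\<lambda>s. (linearized_output f h u x0 (t - T) s *v v) \<bullet> (linearized_output f h u x0 (t - T) s *v w))
        integrable_on {t - T..t}"
proof -
  define x where "x = reference_trajectory f u x0"
  obtain R L where "0 < R" "0 < L"
    and bdd: "\<And>t s \<xi>. T \<le> t \<Longrightarrow> s \<in> {t - T..t} \<Longrightarrow> \<xi> \<in> cball (x (t - T)) R \<Longrightarrow>
          norm (flow f u s (t - T) \<xi>) \<le> L"
    using rb unfolding regularly_bounded_def x_def by metis
  define B where "B = cball (0 :: real ^ 'nx) L"
  have B: "compact B" "convex B" by (simp_all add: B_def)
  obtain Df Mf where "1 \<le> Mf" and
    derf: "\<And>x v. ((\<lambda>x. f x v) has_derivative Df x v) (at x)" and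
    f_bounds: "\<And>x v w. x \<in> B \<Longrightarrow> v \<in> U \<Longrightarrow> norm (Df x v w) \<le> Mf * norm w"
      "\<And>x y v. x \<in> B \<Longrightarrow> y \<in> B \<Longrightarrow> v \<in> U \<Longrightarrow> norm (f y v - f x v) \<le> Mf * norm (y - x)"
      "\<And>x y z v r. x \<in> B \<Longrightarrow> y \<in> B \<Longrightarrow> z \<in> B \<Longrightarrow> v \<in> U \<Longrightarrow> norm (y - x) \<le> r \<Longrightarrow> norm (z - x) \<le> r \<Longrightarrow>
           norm (f y v - f z v - Df x v (y - z)) \<le> Mf * r * norm (y - z)"
    by (rule three_times_continuously_differentiable_bounds[OF f B U]) (rule that; assumption)
  obtain Dh Mh where "1 \<le> Mh" and
    derh: "\<And>x v. ((\<lambda>x. h x v) has_derivative Dh x v) (at x)" and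
    conth: "continuous_on UNIV (\<lambda>(x, v). h x v)" and
    contDh: "\<And>w. continuous_on UNIV (\<lambda>(x, v). Dh x v w)" and
    Dhb: "\<And>x v w. x \<in> B \<Longrightarrow> v \<in> U \<Longrightarrow> norm (Dh x v w) \<le> Mh * norm w" and
    liph: "\<And>x y v. x \<in> B \<Longrightarrow> y \<in> B \<Longrightarrow> v \<in> U \<Longrightarrow> norm (h y v - h x v) \<le> Mh * norm (y - x)" and
    remh: "\<And>x y z v r. x \<in> B \<Longrightarrow> y \<in> B \<Longrightarrow> z \<in> B \<Longrightarrow> v \<in> U \<Longrightarrow> norm (y - x) \<le> r \<Longrightarrow> norm (z - x) \<le> r \<Longrightarrow>
           norm (h y v - h z v - Dh x v (y - z)) \<le> Mh * r * norm (y - z)"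
    by (rule three_times_continuously_differentiable_bounds[OF h B U]) (rule that; assumption)
  define E where "E = exp ((2 * Mf + 1) * T)"
  have E0: "0 < E" by (simp add: E_def)
  \<comment> \<open>The first summand comes from linearizing \<open>h\<close> at states within
    \<open>E * r\<close> of the reference and at most \<open>E * norm (\<xi>1 - \<xi>2)\<close>
    apart; the second is the remainder of the flow passed through the derivative of
    \<open>h\<close>.\<close>
  define C where "C = Mh * E * E + Mh * E * (Mf * E * E)"
  have "\<exists>D. (\<forall>s\<in>{t - T..t}. (flow f u s (t - T) has_derivative D s) (at (x (t - T)))) \<and>
      (\<forall>v. continuous_on {t - T..t} (\<lambda>s. D s v)) \<and>
      (\<forall>s r \<xi>1 \<xi>2. s \<in> {t - T..t} \<longrightarrow> r \<le> R \<longrightarrow> \<xi>1 \<in> cball (x (t - T)) r \<longrightarrow> \<xi>2 \<in> cball (x (t - T)) r \<longrightarrow>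
        norm (flow f u s (t - T) \<xi>1 - flow f u s (t - T) \<xi>2 - D s (\<xi>1 - \<xi>2))
          \<le> E * (Mf * E * E * r * norm (\<xi>1 - \<xi>2))) \<and>
      (\<forall>s \<xi>1 \<xi>2. s \<in> {t - T..t} \<longrightarrow> \<xi>1 \<in> cball (x (t - T)) R \<longrightarrow> \<xi>2 \<in> cball (x (t - T)) R \<longrightarrow>
        norm (flow f u s (t - T) \<xi>1 - flow f u s (t - T) \<xi>2) \<le> E * norm (\<xi>1 - \<xi>2))" (is "\<exists>D. ?P t D")
    if t: "T \<le> t" for t
  proof -
    have a: "0 \<le> t - T" and M: "0 \<le> Mf" using t \<open>1 \<le> Mf\<close> by auto
    have inB: "flow f u s (t - T) \<xi> \<in> B" if "s \<in> {t - T..t}" "\<xi> \<in> cball (x (t - T)) R" for s \<xi>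
      using bdd[OF t that] by (simp add: B_def)
    have E: "E = exp ((2 * Mf + 1) * (t - (t - T)))" by (simp add: E_def)
    show ?thesis
      by (rule flow_linearization[OF sol u a \<open>0 < R\<close> M inB derf f_bounds E], assumption+)
        (intro exI conjI ballI allI impI; assumption)
  qed
  then have "\<forall>t. \<exists>D. T \<le> t \<longrightarrow> ?P t D" by blast
  from choice[OF this] obtain D where D: "\<And>t. T \<le> t \<Longrightarrow> ?P t (D t)" by blast
  \<comment> \<open>The flow is linearized along the solution from \<open>x (t - T)\<close>, whereas
    the Grammian evaluates the derivative of \<open>h\<close> along the reference trajectory; here
    the two curves are matched.\<close>
  have flow_x: "flow f u s (t - T) (x (t - T)) = x s" if "T \<le> t" "s \<in> {t - T..t}" for t s
    unfolding x_def reference_trajectory_def using that by (intro flow_flow[OF sol u]) auto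
  have inB: "flow f u s (t - T) \<xi> \<in> B" if "T \<le> t" "s \<in> {t - T..t}" "\<xi> \<in> cball (x (t - T)) R" for t s \<xi>
    using bdd[OF that] by (simp add: B_def)
  have xB: "x s \<in> B" if "T \<le> t" "s \<in> {t - T..t}" for t s
    using inB[OF that, of "x (t - T)"] flow_x[OF that] \<open>0 < R\<close> by simp
  have uU: "u s \<in> U" if "T \<le> t" "s \<in> {t - T..t}" for t s
    using u that by (simp add: input_trajectory_def)
  have N: "linearized_output f h u x0 (t - T) s *v v = Dh (x s) (u s) (D t s v)"
    if "T \<le> t" "s \<in> {t - T..t}" for t s v
  proof -
    have "(flow f u s (t - T) has_derivative D t s) (at (x (t - T)))"
      using D[OF that(1)] that(2) by blast
    then show ?thesis
      unfolding linearized_output_def output_differential_def flow_differential_def x_def[symmetric]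
      by (simp add: matrix_vector_mul_assoc[symmetric] jacobian_mult_vec[OF derh] jacobian_mult_vec)
  qed
  define S where "S t = {s \<in> {0..t}. \<not> continuous (at s within {0..}) u}" for t
  have S: "finite (S t)" for t
    using u by (simp add: S_def input_trajectory_def piecewise_continuous_def)
  have contu: "continuous_on ({t - T..t} - S t) u" if "T \<le> t" for t
  proof -
    have "continuous (at s within {t - T..t} - S t) u" if s: "s \<in> {t - T..t} - S t" for s
    proof (rule continuous_within_subset)
      show "continuous (at s within {0..}) u" using s \<open>T \<le> t\<close> by (simp add: S_def)
      show "{t - T..t} - S t \<subseteq> {0..}" using \<open>T \<le> t\<close> by auto
    qed
    then show ?thesis unfolding continuous_on_eq_continuous_within by blast
  qed
  have contx: "continuous_on ({t - T..t} - S t) x" if "T \<le> t" for t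
  proof -
    have "continuous_on {0..t} (\<lambda>s. flow f u s 0 x0)"
      by (rule continuous_on_flow[OF sol u order_refl])
    then have "continuous_on {0..t} x"
      by (simp add: x_def reference_trajectory_def[abs_def])
    then show ?thesis
      by (rule continuous_on_subset) (use \<open>T \<le> t\<close> in force)
  qed
  have contflow: "continuous_on ({t - T..t} - S t) (\<lambda>s. flow f u s (t - T) \<xi>)" if "T \<le> t" for t \<xi>
  proof -
    have a: "0 \<le> t - T" using that by simp
    show ?thesis
      by (rule continuous_on_subset[OF continuous_on_flow[OF sol u a, where b = t]]) blast
  qed
  show thesis
  proof (rule that[of R C])
    show "0 < R" by fact
    show "0 \<le> C" using \<open>1 \<le> Mf\<close> \<open>1 \<le> Mh\<close> E0 by (simp add: C_def)
  next
    fix t s r \<xi>1 \<xi>2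
    assume t: "T \<le> t" and s: "s \<in> {t - T..t}" and r: "r \<le> R"
      and "\<xi>1 \<in> cball (reference_trajectory f u x0 (t - T)) r"
          "\<xi>2 \<in> cball (reference_trajectory f u x0 (t - T)) r"
    then have \<xi>: "\<xi>1 \<in> cball (x (t - T)) r" "\<xi>2 \<in> cball (x (t - T)) r" by (simp_all add: x_def)
    have r0: "0 \<le> r" using \<xi>(1) by (meson mem_cball order_trans zero_le_dist)
    have \<xi>R: "\<xi>1 \<in> cball (x (t - T)) R" "\<xi>2 \<in> cball (x (t - T)) R" using r \<xi> by auto
    let ?y1 = "flow f u s (t - T) \<xi>1" and ?y2 = "flow f u s (t - T) \<xi>2"
    have near: "norm (flow f u s (t - T) \<xi> - x s) \<le> E * r" if "\<xi> \<in> cball (x (t - T)) r" for \<xi>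
    proof -
      have "\<xi> \<in> cball (x (t - T)) R" "x (t - T) \<in> cball (x (t - T)) R" using that r r0 by auto
      then have "norm (flow f u s (t - T) \<xi> - flow f u s (t - T) (x (t - T))) \<le> E * norm (\<xi> - x (t - T))"
        using D[OF t] s by blast
      also have "\<dots> \<le> E * r"
        using that E0 by (simp add: dist_norm norm_minus_commute)
      finally show ?thesis by (simp add: flow_x[OF t s])
    qed
    have lip: "norm (?y1 - ?y2) \<le> E * norm (\<xi>1 - \<xi>2)"
      using D[OF t] s \<xi>R by blast
    have rem: "norm (?y1 - ?y2 - D t s (\<xi>1 - \<xi>2)) \<le> E * (Mf * E * E * r * norm (\<xi>1 - \<xi>2))"
      using D[OF t] s r \<xi> by blast
    have lin: "linear (Dh (x s) (u s))" using derh has_derivative_linear by blast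
    have "norm (h ?y1 (u s) - h ?y2 (u s) - Dh (x s) (u s) (?y1 - ?y2)) \<le> Mh * (E * r) * norm (?y1 - ?y2)"
      using t s \<xi> by (intro remh near xB[OF t s] inB[OF t s \<xi>R(1)] inB[OF t s \<xi>R(2)] uU[OF t s])
    also have "\<dots> \<le> Mh * (E * r) * (E * norm (\<xi>1 - \<xi>2))"
      using \<open>1 \<le> Mh\<close> E0 r0 by (intro mult_left_mono lip) auto
    finally have 1: "norm (h ?y1 (u s) - h ?y2 (u s) - Dh (x s) (u s) (?y1 - ?y2))
      \<le> Mh * (E * r) * (E * norm (\<xi>1 - \<xi>2))" .
    have "norm (Dh (x s) (u s) (?y1 - ?y2 - D t s (\<xi>1 - \<xi>2))) \<le> Mh * norm (?y1 - ?y2 - D t s (\<xi>1 - \<xi>2))"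
      by (rule Dhb[OF xB[OF t s] uU[OF t s]])
    also have "\<dots> \<le> Mh * (E * (Mf * E * E * r * norm (\<xi>1 - \<xi>2)))"
      using \<open>1 \<le> Mh\<close> by (intro mult_left_mono rem) auto
    finally have 2: "norm (Dh (x s) (u s) (?y1 - ?y2) - Dh (x s) (u s) (D t s (\<xi>1 - \<xi>2)))
      \<le> Mh * (E * (Mf * E * E * r * norm (\<xi>1 - \<xi>2)))"
      by (simp add: linear_diff[OF lin])
    have "norm (h ?y1 (u s) - h ?y2 (u s) - Dh (x s) (u s) (D t s (\<xi>1 - \<xi>2)))
      \<le> Mh * (E * r) * (E * norm (\<xi>1 - \<xi>2)) + Mh * (E * (Mf * E * E * r * norm (\<xi>1 - \<xi>2)))"
      using norm_triangle_mono[OF 1 2] by (simp only: add_diff_eq diff_add_cancel)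
    also have "\<dots> = C * r * norm (\<xi>1 - \<xi>2)"
      by (simp add: C_def algebra_simps)
    finally show "norm (h ?y1 (u s) - h ?y2 (u s) - linearized_output f h u x0 (t - T) s *v (\<xi>1 - \<xi>2))
      \<le> C * r * norm (\<xi>1 - \<xi>2)"
      by (simp only: N[OF t s])
  next
    fix t \<xi>1 \<xi>2
    assume t: "T \<le> t"
      and "\<xi>1 \<in> cball (reference_trajectory f u x0 (t - T)) R"
          "\<xi>2 \<in> cball (reference_trajectory f u x0 (t - T)) R"
    then have \<xi>R: "\<xi>1 \<in> cball (x (t - T)) R" "\<xi>2 \<in> cball (x (t - T)) R" by (simp_all add: x_def)
    have "continuous_on ({t - T..t} - S t) (\<lambda>s. h (flow f u s (t - T) \<xi>) (u s))" for \<xi>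
      using continuous_on_compose2[OF conth continuous_on_Pair[OF contflow[OF t] contu[OF t]]] by simp
    then have cont: "continuous_on ({t - T..t} - S t)
        (\<lambda>s. (norm (h (flow f u s (t - T) \<xi>1) (u s) - h (flow f u s (t - T) \<xi>2) (u s)))\<^sup>2)"
      by (intro continuous_intros)
    show "(\<lambda>s. (norm (h (flow f u s (t - T) \<xi>1) (u s) - h (flow f u s (t - T) \<xi>2) (u s)))\<^sup>2)
        integrable_on {t - T..t}"
    proof (rule integrable_on_bounded_continuous_off_finite[OF S cont])
      fix s assume "s \<in> {t - T..t} - S t"
      then have s: "s \<in> {t - T..t}" by simp
      have "norm (h (flow f u s (t - T) \<xi>1) (u s) - h (flow f u s (t - T) \<xi>2) (u s))
          \<le> Mh * norm (flow f u s (t - T) \<xi>1 - flow f u s (t - T) \<xi>2)"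
        by (intro liph inB[OF t s] uU[OF t s] \<xi>R)
      also have "\<dots> \<le> Mh * (E * norm (\<xi>1 - \<xi>2))"
        using D[OF t] s \<xi>R \<open>1 \<le> Mh\<close> by (intro mult_left_mono) auto
      finally have "(norm (h (flow f u s (t - T) \<xi>1) (u s) - h (flow f u s (t - T) \<xi>2) (u s)))\<^sup>2
          \<le> (Mh * (E * norm (\<xi>1 - \<xi>2)))\<^sup>2" by (rule power_mono) simp
      then show "norm ((norm (h (flow f u s (t - T) \<xi>1) (u s) - h (flow f u s (t - T) \<xi>2) (u s)))\<^sup>2)
          \<le> (Mh * (E * norm (\<xi>1 - \<xi>2)))\<^sup>2" by simp
    qed
  next
    fix t v w assume t: "T \<le> t"
    have contD: "continuous_on {t - T..t} (\<lambda>s. D t s v)" for v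
      using D[OF t] by blast
    \<comment> \<open>This bound may depend on the window and on \<open>v\<close>, since it serves
      only integrability.\<close>
    obtain K where K: "\<And>v s. s \<in> {t - T..t} \<Longrightarrow> norm (D t s v) \<le> K v"
    proof -
      have "\<exists>k. \<forall>s\<in>{t - T..t}. norm (D t s v) \<le> k" for v
        using compact_imp_bounded[OF compact_continuous_image[OF contD compact_Icc]]
        unfolding bounded_iff by blast
      then show ?thesis using that by metis
    qed
    have lin: "linear (Dh (x s) (u s))" for s using derh has_derivative_linear by blast
    \<comment> \<open>Continuity of \<open>Dh\<close> in its base point is available for each fixed
      direction, but here the direction moves with \<open>s\<close>. Expansion in the basis
      separates the two dependences.\<close>
    have exp: "Dh (x s) (u s) (D t s v) = (\<Sum>i\<in>Basis. (D t s v \<bullet> i) *\<^sub>R Dh (x s) (u s) i)" for s v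
    proof -
      have "Dh (x s) (u s) (D t s v) = Dh (x s) (u s) (\<Sum>i\<in>Basis. (D t s v \<bullet> i) *\<^sub>R i)"
        by (simp only: euclidean_representation)
      then show ?thesis by (simp add: linear_sum[OF lin] linear_scale[OF lin])
    qed
    have "continuous_on ({t - T..t} - S t) (\<lambda>s. Dh (x s) (u s) i)" for i
      using continuous_on_compose2[OF contDh continuous_on_Pair[OF contx[OF t] contu[OF t]]] by simp
    then have "continuous_on ({t - T..t} - S t) (\<lambda>s. Dh (x s) (u s) (D t s v))" for v
      unfolding exp by (intro continuous_intros continuous_on_subset[OF contD]) auto
    then have cont: "continuous_on ({t - T..t} - S t)
        (\<lambda>s. Dh (x s) (u s) (D t s v) \<bullet> Dh (x s) (u s) (D t s w))"
      by (intro continuous_intros)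
    have bd: "norm (Dh (x s) (u s) (D t s v)) \<le> Mh * K v" if s: "s \<in> {t - T..t}" for s v
    proof -
      have "norm (Dh (x s) (u s) (D t s v)) \<le> Mh * norm (D t s v)"
        by (rule Dhb[OF xB[OF t s] uU[OF t s]])
      also have "\<dots> \<le> Mh * K v" using K[OF s] \<open>1 \<le> Mh\<close> by (intro mult_left_mono) auto
      finally show ?thesis .
    qed
    have "(\<lambda>s. Dh (x s) (u s) (D t s v) \<bullet> Dh (x s) (u s) (D t s w)) integrable_on {t - T..t}"
    proof (rule integrable_on_bounded_continuous_off_finite[OF S cont])
      fix s assume "s \<in> {t - T..t} - S t"
      then have s: "s \<in> {t - T..t}" by simp
      have "norm (Dh (x s) (u s) (D t s v) \<bullet> Dh (x s) (u s) (D t s w))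
          \<le> norm (Dh (x s) (u s) (D t s v)) * norm (Dh (x s) (u s) (D t s w))"
        by (simp add: Cauchy_Schwarz_ineq2)
      also have "\<dots> \<le> (Mh * K v) * (Mh * K w)"
        using bd[OF s] order_trans[OF norm_ge_zero bd[OF s]] by (intro mult_mono) auto
      finally show "norm (Dh (x s) (u s) (D t s v) \<bullet> Dh (x s) (u s) (D t s w)) \<le> (Mh * K v) * (Mh * K w)" .
    qed
    then show "(\<lambda>s. (linearized_output f h u x0 (t - T) s *v v) \<bullet> (linearized_output f h u x0 (t - T) s *v w))
        integrable_on {t - T..t}"
      by (rule integrable_eq) (simp add: N[OF t])
  qed
qed

section \<open>The Grammian as a quadratic form\<close>

lemma inner_transpose_mult_self:
  fixes N :: "real ^ 'n ^ 'm"
  shows "v \<bullet> ((transpose N ** N) *v w) = (N *v v) \<bullet> (N *v w)"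
  by (metis dot_lmul_matrix inner_commute matrix_vector_mul_assoc transpose_matrix_vector)

lemma matrix_entry_eq_inner:
  fixes A :: "real ^ 'n ^ 'm"
  shows "A $ i $ j = axis i 1 \<bullet> (A *v axis j 1)"
  by (simp add: matrix_vector_mult_basis column_def inner_axis')

text \<open>A linear functional of the matrix commutes with the integral once the matrix is
  integrable. Its entries are inner products along pairs of axis vectors, which is why the
  hypothesis ranges over pairs \<open>v\<close>, \<open>w\<close> and not only over squares.\<close>

lemma inner_integral_transpose_mult_self:
  fixes N :: "real \<Rightarrow> real ^ 'n ^ 'm"
  assumes int: "\<And>v w. (\<lambda>s. (N s *v v) \<bullet> (N s *v w)) integrable_on S"
  shows "v \<bullet> (integral S (\<lambda>s. transpose (N s) ** N s) *v w) = integral S (\<lambda>s. (N s *v v) \<bullet> (N s *v w))"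
proof -
  have "(\<lambda>s. (transpose (N s) ** N s) \<bullet> b) integrable_on S" if "b \<in> Basis" for b
  proof -
    from that obtain i j where b: "b = axis i (axis j 1)" by (auto simp: Basis_vec_def)
    have "(transpose (N s) ** N s) \<bullet> b = (N s *v axis i 1) \<bullet> (N s *v axis j 1)" for s
    proof -
      have "(transpose (N s) ** N s) \<bullet> b = (transpose (N s) ** N s) $ i $ j"
        by (simp add: b inner_axis)
      then show ?thesis by (simp add: matrix_entry_eq_inner inner_transpose_mult_self)
    qed
    then show ?thesis using int by simp
  qed
  then have M: "(\<lambda>s. transpose (N s) ** N s) integrable_on S"
    using integrable_componentwise_iff by blast
  have "linear (\<lambda>A :: real ^ 'n ^ 'n. v \<bullet> (A *v w))"
    by (rule linearI)
      (simp_all add: matrix_vector_mult_add_rdistrib inner_add_right scaleR_matrix_vector_assoc[symmetric])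
  then have "bounded_linear (\<lambda>A :: real ^ 'n ^ 'n. v \<bullet> (A *v w))"
    by (simp add: linear_conv_bounded_linear)
  from integral_linear[OF M this] show ?thesis
    by (simp add: o_def inner_transpose_mult_self)
qed

text \<open>The Loewner order includes symmetry of the difference; it follows entrywise from the
  symmetry of the bilinear form, and only the quadratic form remains to be compared.\<close>

lemma loewner_ge_integral_transpose_mult_self:
  fixes N :: "real \<Rightarrow> real ^ 'n ^ 'm"
  assumes int: "\<And>v w. (\<lambda>s. (N s *v v) \<bullet> (N s *v w)) integrable_on S"
  shows "integral S (\<lambda>s. transpose (N s) ** N s) \<succeq> \<mu> *\<^sub>R mat 1 \<longleftrightarrow>
    (\<forall>v. \<mu> * (norm v)\<^sup>2 \<le> integral S (\<lambda>s. (norm (N s *v v))\<^sup>2))"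
proof -
  define G where "G = integral S (\<lambda>s. transpose (N s) ** N s)"
  have G: "v \<bullet> (G *v w) = integral S (\<lambda>s. (N s *v v) \<bullet> (N s *v w))" for v w
    unfolding G_def by (rule inner_integral_transpose_mult_self[OF int])
  have "G $ i $ j = G $ j $ i" for i j
    unfolding matrix_entry_eq_inner G by (simp add: inner_commute)
  then have sym: "transpose (G - \<mu> *\<^sub>R mat 1) = G - \<mu> *\<^sub>R mat 1"
    by (simp add: vec_eq_iff transpose_def mat_def)
  have "v \<bullet> ((G - \<mu> *\<^sub>R mat 1) *v v) = integral S (\<lambda>s. (norm (N s *v v))\<^sup>2) - \<mu> * (norm v)\<^sup>2" for v
    by (simp add: matrix_vector_mult_diff_rdistrib inner_diff_right G
        scaleR_matrix_vector_assoc[symmetric] power2_norm_eq_inner)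
  then show ?thesis
    by (simp add: loewner_ge_def positive_semidefinite_def sym G_def[symmetric])
qed

lemma observability_grammian_eq:
  "observability_grammian f h u x0 t T = integral {t - T..t} (\<lambda>s.
     transpose (linearized_output f h u x0 (t - T) s) ** linearized_output f h u x0 (t - T) s)"
  unfolding observability_grammian_def linearized_output_def Let_def matrix_transpose_mul
  by (simp add: matrix_mul_assoc)

section \<open>Transfer of quadratic lower bounds\<close>

text \<open>The hypotheses treat \<open>p\<close> and \<open>q\<close> alike, so the lemma serves
  both directions: the linearized output is \<open>q\<close> in the first and \<open>p\<close> in
  the second.\<close>

lemma integral_norm_sq_perturbation:
  fixes p q :: "real \<Rightarrow> 'a::real_normed_vector"
  assumes "a \<le> b"
    and p: "(\<lambda>s. (norm (p s))\<^sup>2) integrable_on {a..b}"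
    and q: "(\<lambda>s. (norm (q s))\<^sup>2) integrable_on {a..b}"
    and diff: "\<And>s. s \<in> {a..b} \<Longrightarrow> norm (p s - q s) \<le> k"
  shows "integral {a..b} (\<lambda>s. (norm (q s))\<^sup>2) / 2 - (b - a) * k\<^sup>2 \<le> integral {a..b} (\<lambda>s. (norm (p s))\<^sup>2)"
proof -
  have "(norm (q s))\<^sup>2 / 2 - k\<^sup>2 \<le> (norm (p s))\<^sup>2" if s: "s \<in> {a..b}" for s
  proof -
    have "norm (q s) \<le> norm (p s) + k"
      using diff[OF s] norm_triangle_ineq2[of "q s" "p s"] by (simp add: norm_minus_commute)
    then have "(norm (q s))\<^sup>2 \<le> (norm (p s) + k)\<^sup>2" by (rule power_mono) simp
    also have "\<dots> \<le> 2 * (norm (p s))\<^sup>2 + 2 * k\<^sup>2"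
      using sum_squares_bound[of "norm (p s)" k] by (simp add: power2_sum)
    finally show ?thesis by simp
  qed
  moreover have q2: "(\<lambda>s. (norm (q s))\<^sup>2 / 2) integrable_on {a..b}"
    using has_integral_divide[OF integrable_integral[OF q]] by blast
  ultimately have "integral {a..b} (\<lambda>s. (norm (q s))\<^sup>2 / 2 - k\<^sup>2) \<le> integral {a..b} (\<lambda>s. (norm (p s))\<^sup>2)"
    using p by (intro integral_le integrable_diff integrable_const_ivl)
  moreover have "integral {a..b} (\<lambda>s. (norm (q s))\<^sup>2 / 2 - k\<^sup>2)
      = integral {a..b} (\<lambda>s. (norm (q s))\<^sup>2) / 2 - (b - a) * k\<^sup>2"
    using q2 \<open>a \<le> b\<close> by (simp add: integral_diff integrable_const_ivl)
  ultimately show ?thesis by simp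
qed

lemma small_radius_exists:
  fixes T C R e :: real
  assumes "0 \<le> T" "0 < R" "0 < e"
  obtains r where "0 < r" "r \<le> R" "T * (C * r)\<^sup>2 \<le> e"
proof -
  define r where "r = min R (sqrt (e / (T * C\<^sup>2 + 1)))"
  have pos: "0 < T * C\<^sup>2 + 1" using assms by (simp add: add_nonneg_pos)
  have r: "0 < r" "r \<le> R" using assms pos by (auto simp: r_def)
  have "r\<^sup>2 \<le> (sqrt (e / (T * C\<^sup>2 + 1)))\<^sup>2"
    using r by (intro power_mono) (auto simp: r_def)
  also have "\<dots> = e / (T * C\<^sup>2 + 1)" using assms pos by simp
  finally have "(T * C\<^sup>2 + 1) * r\<^sup>2 \<le> e" using pos by (simp add: field_simps)
  moreover have "T * (C * r)\<^sup>2 \<le> (T * C\<^sup>2 + 1) * r\<^sup>2"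
    by (simp add: power_mult_distrib algebra_simps)
  ultimately show thesis using that r by fastforce
qed

lemma K_function_quadratic:
  fixes \<mu> :: real
  assumes "0 < \<mu>"
  shows "K_function (\<lambda>z. \<mu> * z\<^sup>2)"
  unfolding K_function_def
  using assms by (auto intro!: continuous_intros strict_mono_onI power_strict_mono mult_strict_left_mono)

text \<open>The infimum itself is taken as \<open>\<gamma>\<close>. It is a lower bound only for a
  family bounded below, which holds because a K-function is nonnegative; the vector 0, excluded from
  the infimum, is covered by \<open>\<kappa> 0 = 0\<close>.\<close>

lemma finite_sensitivity_lower_bound:
  fixes \<kappa> :: "real \<Rightarrow> real"
  assumes "finite_sensitivity TYPE('a::real_normed_vector) \<kappa>" "K_function \<kappa>"
  obtains \<rho> \<gamma> where "0 < \<rho>" "0 < \<gamma>"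
    and "\<And>\<xi> :: 'a. norm \<xi> \<le> \<rho> \<Longrightarrow> \<gamma> * (norm \<xi>)\<^sup>2 \<le> \<kappa> (norm \<xi>)"
proof -
  obtain \<rho> where \<rho>: "0 < \<rho>"
    "0 < (INF \<xi>\<in>{\<xi>::'a. 0 < norm \<xi> \<and> norm \<xi> \<le> \<rho>}. \<kappa> (norm \<xi>) / (norm \<xi>)\<^sup>2)"
    using assms(1) unfolding finite_sensitivity_def by blast
  define \<gamma> where "\<gamma> = (INF \<xi>\<in>{\<xi>::'a. 0 < norm \<xi> \<and> norm \<xi> \<le> \<rho>}. \<kappa> (norm \<xi>) / (norm \<xi>)\<^sup>2)"
  have \<kappa>0: "\<kappa> 0 = 0" and mono: "strict_mono_on {0..} \<kappa>"
    using assms(2) by (auto simp: K_function_def)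
  have nonneg: "0 \<le> \<kappa> z" if "0 \<le> z" for z
    using strict_mono_on_leD[OF mono, of 0 z] that \<kappa>0 by simp
  have bdd: "bdd_below ((\<lambda>\<xi>::'a. \<kappa> (norm \<xi>) / (norm \<xi>)\<^sup>2) ` X)" for X
    using nonneg by (intro bdd_belowI2[where m = 0]) simp
  have "\<gamma> * (norm \<xi>)\<^sup>2 \<le> \<kappa> (norm \<xi>)" if "norm \<xi> \<le> \<rho>" for \<xi> :: 'a
  proof (cases "\<xi> = 0")
    case False
    then have "\<gamma> \<le> \<kappa> (norm \<xi>) / (norm \<xi>)\<^sup>2"
      unfolding \<gamma>_def using that by (intro cINF_lower[OF bdd]) simp
    then show ?thesis using False by (simp add: field_simps)
  qed (simp add: \<kappa>0)
  then show thesis using that[of \<rho> \<gamma>] \<rho> by (simp add: \<gamma>_def)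
qed

theorem corollary4p16:
  fixes f :: "real ^ 'nx \<Rightarrow> real ^ 'nu \<Rightarrow> real ^ 'nx"
    and h :: "real ^ 'nx \<Rightarrow> real ^ 'nu \<Rightarrow> real ^ 'ny"
    and U :: "(real ^ 'nu) set"
    and x0 :: "real ^ 'nx"
    and u :: "real \<Rightarrow> real ^ 'nu"
  assumes "solutions_uniquely_defined f U"
    and "three_times_continuously_differentiable (\<lambda>(x, v). f x v)"
    and "three_times_continuously_differentiable (\<lambda>(x, v). h x v)"
    and "compact U"
    and "input_trajectory U u"
  shows "((\<exists>T>0. \<exists>\<mu>>0. regularly_bounded f u x0 T \<and>
             (\<forall>t\<ge>T. observability_grammian f h u x0 t T \<succeq> \<mu> *\<^sub>R mat 1))
           \<longrightarrow> weakly_regularly_persistent f h u x0)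
       \<and> ((\<exists>T \<kappa>. weakly_regularly_persistent_with f h u x0 T \<kappa> \<and>
             finite_sensitivity TYPE(real ^ 'nx) \<kappa> \<and> regularly_bounded f u x0 T)
           \<longrightarrow> (\<exists>T>0. \<exists>\<mu>>0. \<forall>t\<ge>T. observability_grammian f h u x0 t T \<succeq> \<mu> *\<^sub>R mat 1))"
proof (intro conjI impI)
  let ?x = "reference_trajectory f u x0"
  assume "\<exists>T>0. \<exists>\<mu>>0. regularly_bounded f u x0 T \<and>
             (\<forall>t\<ge>T. observability_grammian f h u x0 t T \<succeq> \<mu> *\<^sub>R mat 1)"
  then obtain T \<mu> where T: "0 < T" and \<mu>: "0 < \<mu>" and rb: "regularly_bounded f u x0 T"
    and gram: "\<And>t. T \<le> t \<Longrightarrow> observability_grammian f h u x0 t T \<succeq> \<mu> *\<^sub>R mat 1" by blast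
  let ?N = "\<lambda>t s. linearized_output f h u x0 (t - T) s"
  obtain R C where "0 < R" "0 \<le> C"
    and rem: "\<And>t s r \<xi>1 \<xi>2. T \<le> t \<Longrightarrow> s \<in> {t - T..t} \<Longrightarrow> r \<le> R \<Longrightarrow>
      \<xi>1 \<in> cball (?x (t - T)) r \<Longrightarrow> \<xi>2 \<in> cball (?x (t - T)) r \<Longrightarrow>
      norm (h (flow f u s (t - T) \<xi>1) (u s) - h (flow f u s (t - T) \<xi>2) (u s) - ?N t s *v (\<xi>1 - \<xi>2))
        \<le> C * r * norm (\<xi>1 - \<xi>2)"
    and int_h: "\<And>t \<xi>1 \<xi>2. T \<le> t \<Longrightarrow> \<xi>1 \<in> cball (?x (t - T)) R \<Longrightarrow> \<xi>2 \<in> cball (?x (t - T)) R \<Longrightarrow>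
      (\<lambda>s. (norm (h (flow f u s (t - T) \<xi>1) (u s) - h (flow f u s (t - T) \<xi>2) (u s)))\<^sup>2)
        integrable_on {t - T..t}"
    and int_N: "\<And>t v w. T \<le> t \<Longrightarrow> (\<lambda>s. (?N t s *v v) \<bullet> (?N t s *v w)) integrable_on {t - T..t}"
    by (rule output_linearization[OF assms rb T]) (rule that; assumption)
  \<comment> \<open>The perturbation inequality halves the Grammian bound to \<mu>/2, and an error
    of at most \<mu>/4 leaves \<mu>/4 as the coefficient of the quadratic K-function.\<close>
  have "0 < \<mu> / 4" using \<mu> by simp
  obtain r where r: "0 < r" "r \<le> R" "T * (C * r)\<^sup>2 \<le> \<mu> / 4"
    using small_radius_exists[OF less_imp_le[OF T] \<open>0 < R\<close> \<open>0 < \<mu> / 4\<close>] .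
  have "\<mu> / 4 * (norm (\<xi>1 - \<xi>2))\<^sup>2 \<le> cumulative_output_error f h (t - T) t \<xi>1 \<xi>2 u"
    if t: "T \<le> t" and \<xi>: "\<xi>1 \<in> cball (?x (t - T)) r" "\<xi>2 \<in> cball (?x (t - T)) r" for t \<xi>1 \<xi>2
  proof -
    have \<xi>R: "\<xi>1 \<in> cball (?x (t - T)) R" "\<xi>2 \<in> cball (?x (t - T)) R" using \<xi> r by auto
    have "\<mu> * (norm (\<xi>1 - \<xi>2))\<^sup>2 \<le> integral {t - T..t} (\<lambda>s. (norm (?N t s *v (\<xi>1 - \<xi>2)))\<^sup>2)"
      using gram[OF t] unfolding observability_grammian_eq loewner_ge_integral_transpose_mult_self[OF int_N[OF t]]
      by blast
    moreover have "integral {t - T..t} (\<lambda>s. (norm (?N t s *v (\<xi>1 - \<xi>2)))\<^sup>2) / 2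
        - (t - (t - T)) * (C * r * norm (\<xi>1 - \<xi>2))\<^sup>2 \<le> cumulative_output_error f h (t - T) t \<xi>1 \<xi>2 u"
      unfolding cumulative_output_error_def
      using T int_N[OF t, of "\<xi>1 - \<xi>2" "\<xi>1 - \<xi>2"]
      by (intro integral_norm_sq_perturbation int_h[OF t \<xi>R] rem[OF t _ r(2) \<xi>])
        (simp_all add: power2_norm_eq_inner)
    moreover have "T * (C * r * norm (\<xi>1 - \<xi>2))\<^sup>2 \<le> \<mu> / 4 * (norm (\<xi>1 - \<xi>2))\<^sup>2"
      using mult_right_mono[OF r(3), of "(norm (\<xi>1 - \<xi>2))\<^sup>2"] by (simp add: power_mult_distrib mult_ac)
    ultimately show ?thesis by simp
  qed
  then have "weakly_regularly_persistent_with f h u x0 T (\<lambda>z. \<mu> / 4 * z\<^sup>2)"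
    unfolding weakly_regularly_persistent_with_def
    using T r(1) K_function_quadratic[OF \<open>0 < \<mu> / 4\<close>] by blast
  then show "weakly_regularly_persistent f h u x0"
    unfolding weakly_regularly_persistent_def by blast
next
  let ?x = "reference_trajectory f u x0"
  assume "\<exists>T \<kappa>. weakly_regularly_persistent_with f h u x0 T \<kappa> \<and>
             finite_sensitivity TYPE(real ^ 'nx) \<kappa> \<and> regularly_bounded f u x0 T"
  then obtain T \<kappa> where wrp: "weakly_regularly_persistent_with f h u x0 T \<kappa>"
    and sens: "finite_sensitivity TYPE(real ^ 'nx) \<kappa>" and rb: "regularly_bounded f u x0 T" by blast
  from wrp obtain R' where T: "0 < T" and \<kappa>: "K_function \<kappa>" and "0 < R'"
    and wrp: "\<And>t \<xi>1 \<xi>2. T \<le> t \<Longrightarrow> \<xi>1 \<in> cball (?x (t - T)) R' \<Longrightarrow> \<xi>2 \<in> cball (?x (t - T)) R' \<Longrightarrow>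
      \<kappa> (norm (\<xi>1 - \<xi>2)) \<le> cumulative_output_error f h (t - T) t \<xi>1 \<xi>2 u"
    unfolding weakly_regularly_persistent_with_def by blast
  obtain \<rho> \<gamma> where "0 < \<rho>" "0 < \<gamma>"
    and \<gamma>: "\<And>\<xi> :: real ^ 'nx. norm \<xi> \<le> \<rho> \<Longrightarrow> \<gamma> * (norm \<xi>)\<^sup>2 \<le> \<kappa> (norm \<xi>)"
    by (rule finite_sensitivity_lower_bound[OF sens \<kappa>]) (rule that; assumption)
  let ?N = "\<lambda>t s. linearized_output f h u x0 (t - T) s"
  obtain R C where "0 < R" "0 \<le> C"
    and rem: "\<And>t s r \<xi>1 \<xi>2. T \<le> t \<Longrightarrow> s \<in> {t - T..t} \<Longrightarrow> r \<le> R \<Longrightarrow>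
      \<xi>1 \<in> cball (?x (t - T)) r \<Longrightarrow> \<xi>2 \<in> cball (?x (t - T)) r \<Longrightarrow>
      norm (h (flow f u s (t - T) \<xi>1) (u s) - h (flow f u s (t - T) \<xi>2) (u s) - ?N t s *v (\<xi>1 - \<xi>2))
        \<le> C * r * norm (\<xi>1 - \<xi>2)"
    and int_h: "\<And>t \<xi>1 \<xi>2. T \<le> t \<Longrightarrow> \<xi>1 \<in> cball (?x (t - T)) R \<Longrightarrow> \<xi>2 \<in> cball (?x (t - T)) R \<Longrightarrow>
      (\<lambda>s. (norm (h (flow f u s (t - T) \<xi>1) (u s) - h (flow f u s (t - T) \<xi>2) (u s)))\<^sup>2)
        integrable_on {t - T..t}"
    and int_N: "\<And>t v w. T \<le> t \<Longrightarrow> (\<lambda>s. (?N t s *v v) \<bullet> (?N t s *v w)) integrable_on {t - T..t}"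
    by (rule output_linearization[OF assms rb T]) (rule that; assumption)
  have "0 < min R (min R' \<rho>)" "0 < \<gamma> / 4"
    using \<open>0 < R\<close> \<open>0 < R'\<close> \<open>0 < \<rho>\<close> \<open>0 < \<gamma>\<close> by simp_all
  \<comment> \<open>The three radii are those of the linearization, of persistence and of finite
    sensitivity; as before, a quarter of the constant is spent on the error.\<close>
  then obtain r where r: "0 < r" "r \<le> R" "r \<le> R'" "r \<le> \<rho>" "T * (C * r)\<^sup>2 \<le> \<gamma> / 4"
    using small_radius_exists[OF less_imp_le[OF T], of "min R (min R' \<rho>)" "\<gamma> / 4" C] by auto
  have small: "\<gamma> / 4 * (norm d)\<^sup>2 \<le> integral {t - T..t} (\<lambda>s. (norm (?N t s *v d))\<^sup>2)"
    if t: "T \<le> t" and d: "norm d \<le> r" for t d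
  proof -
    \<comment> \<open>For the Grammian it suffices to compare with the reference state itself, so
      that \<open>d\<close> is the difference of the two initial values.\<close>
    let ?\<xi>1 = "?x (t - T) + d" and ?\<xi>2 = "?x (t - T)"
    have \<xi>: "?\<xi>1 \<in> cball (?x (t - T)) r" "?\<xi>2 \<in> cball (?x (t - T)) r"
      using d r by (auto simp: dist_norm)
    have \<xi>R: "?\<xi>1 \<in> cball (?x (t - T)) R" "?\<xi>2 \<in> cball (?x (t - T)) R" using \<xi> r by auto
    have "\<gamma> * (norm d)\<^sup>2 \<le> \<kappa> (norm (?\<xi>1 - ?\<xi>2))" using \<gamma>[of d] d r by simp
    also have "\<dots> \<le> cumulative_output_error f h (t - T) t ?\<xi>1 ?\<xi>2 u"
      by (rule wrp[OF t]) (use \<xi> r in auto)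
    finally have "\<gamma> * (norm d)\<^sup>2 \<le> cumulative_output_error f h (t - T) t ?\<xi>1 ?\<xi>2 u" .
    moreover have "cumulative_output_error f h (t - T) t ?\<xi>1 ?\<xi>2 u / 2 - (t - (t - T)) * (C * r * norm d)\<^sup>2
        \<le> integral {t - T..t} (\<lambda>s. (norm (?N t s *v d))\<^sup>2)"
      unfolding cumulative_output_error_def
    proof (rule integral_norm_sq_perturbation[OF _ _ int_h[OF t \<xi>R]])
      show "(\<lambda>s. (norm (?N t s *v d))\<^sup>2) integrable_on {t - T..t}"
        using int_N[OF t, of d d] by (simp add: power2_norm_eq_inner)
      fix s assume "s \<in> {t - T..t}"
      from rem[OF t this r(2) \<xi>]
      show "norm (?N t s *v d - (h (flow f u s (t - T) ?\<xi>1) (u s) - h (flow f u s (t - T) ?\<xi>2) (u s)))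
          \<le> C * r * norm d"
        by (simp add: norm_minus_commute)
    qed (use T in simp)
    moreover have "T * (C * r * norm d)\<^sup>2 \<le> \<gamma> / 4 * (norm d)\<^sup>2"
      using mult_right_mono[OF r(5), of "(norm d)\<^sup>2"] by (simp add: power_mult_distrib mult_ac)
    ultimately show ?thesis by simp
  qed
  have "\<gamma> / 4 * (norm v)\<^sup>2 \<le> integral {t - T..t} (\<lambda>s. (norm (?N t s *v v))\<^sup>2)"
    if t: "T \<le> t" for t and v :: "real ^ 'nx"
  proof (cases "v = 0")
    case False
    \<comment> \<open>This scales \<open>v\<close> to length \<open>r\<close>, where
      \<open>small\<close> applies; both sides are homogeneous of degree two, so the factor
      \<open>k\<^sup>2\<close> cancels.\<close>
    define k where "k = r / norm v"
    have k: "0 < k" "norm (k *\<^sub>R v) \<le> r" using False r by (simp_all add: k_def)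
    have "k\<^sup>2 * (\<gamma> / 4 * (norm v)\<^sup>2) \<le> k\<^sup>2 * integral {t - T..t} (\<lambda>s. (norm (?N t s *v v))\<^sup>2)"
      using small[OF t k(2)] by (simp add: matrix_vector_mult_scaleR power_mult_distrib mult_ac)
    then show ?thesis using k(1) by simp
  qed simp
  then have "observability_grammian f h u x0 t T \<succeq> (\<gamma> / 4) *\<^sub>R mat 1" if "T \<le> t" for t
    using that unfolding observability_grammian_eq loewner_ge_integral_transpose_mult_self[OF int_N[OF that]]
    by blast
  then show "\<exists>T>0. \<exists>\<mu>>0. \<forall>t\<ge>T. observability_grammian f h u x0 t T \<succeq> \<mu> *\<^sub>R mat 1"
    using T \<open>0 < \<gamma> / 4\<close> by blast
qed

end
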